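(* In the steady state of the entrepreneur economy described in the context, with constant tax rate $\tau\in[0,1)$, idiosyncratic volatility $\sigma>0$ and bankruptcy rate $\lambda>0$, the stationary wealth distribution of entrepreneurs is double Pareto. Its (upper-tail) Pareto exponent is $$\alpha=\frac12\left(1+\sqrt{1+\frac{8\lambda}{(1-\tau)^2\sigma^2}}\right),$$ which is increasing in the marginal tax rate $\tau$.
   Context: Model. Time is continuous. There is mass $1$ of entrepreneurs and mass $L>0$ of workers. Workers inelastically supply one unit of labor, earn the wage $\omega_t$ and consume it entirely. Entrepreneurs operate firms with capital $k_t$ and labor $l_t$, trade risk-free bonds $b_t$ in zero net supply at interest rate $r_t$, and go bankrupt (exit) at Poisson rate $\lambda>0$. Net worth $w_t=k_t+b_t$ evolves as $$dw_t=(1-\tau_t)\bigl((F(k_t,l_t)-\omega_tl_t)\,dt+\sigma k_t\,dB_t+r_tb_t\,dt\bigr)-c_t\,dt,$$ with $\tau_t\in[0,1)$ the marginal tax rate, $\sigma>0$, and $B_t$ a standard Brownian motion independent across entrepreneurs. Exiting entrepreneurs are replaced by new ones; their capital is recycled, and each new entrepreneur's initial endowment equals the average capital of exiting entrepreneurs. Tax revenue is used in a way that does not affect the behavior of entrepreneurs. Production: $F$ is homogeneous of degree 1, and $f(k):=F(k,1)$ is twice continuously differentiable on $(0,\infty)$ with $f''<0$, $f'(0)=\infty$, $f'(\infty)\le0$. Preferences: an entrepreneur maximizes the recursive utility $U_t=E_t\int_t^\infty h(c_s,U_s)\,ds$, where $h(c,v)=\beta v\bigl((1-\gamma)\log c-\log[(1-\gamma)v]\bigr)$,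 with discount rate $\beta>0$ (incorporating bankruptcy risk) and relative risk aversion $\gamma>0$, $\gamma\ne1$, subject to the budget constraint and $k_t,l_t,c_t\ge0$, taking $(r_t,\omega_t)$ as given. Equilibrium: entrepreneurs optimize, and the bond and labor markets clear. Writing $K$ for aggregate capital, the equilibrium conditions yield $b_t=0$ for every entrepreneur, consumption $c=\beta w$, capital-labor ratio $k/l=K/L$, individual wealth (capital) dynamics $$dk=[(1-\tau)f'(K/L)-\beta]k\,dt+(1-\tau)\sigma k\,dB,$$ and aggregate dynamics $dK=[(1-\tau)f'(K/L)-\beta]K\,dt$. In the steady state ($\tau$ and $K$ constant), $f'(K/L)=\beta/(1-\tau)$. The stationary wealth distribution is the stationary cross-sectional distribution of $k$ under these individual dynamics with exit at Poisson rate $\lambda$ and replacement at the average capital level. A distribution on $(0,\infty)$ is double Pareto if for some $x_0,\alpha,\kappa>0$ its density is $\frac{\alpha\kappa}{\alpha+\kappa}\frac1{x_0}(x/x_0)^{-\alpha-1}$ for $x\ge x_0$ and $\frac{\alpha\kappa}{\alpha+\kappa}\frac1{x_0}(x/x_0)^{\kappa-1}$ for $0<x<x_0$; $\alpha$ is its Pareto exponent. *)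

theory Defs
  imports "HOL-Probability.Probability"
begin

section \<open>Brownian motion and stochastic differential equations\<close>

text \<open>Time is \<open>[0, \<infinity>)\<close>. Filtrations and processes are indexed by \<open>real\<close> to fit the library locale
  \<open>filtration\<close>; only indices \<open>t \<ge> 0\<close> matter.\<close>

definition standard_brownian_motion ::
  "'a measure \<Rightarrow> (real \<Rightarrow> 'a measure) \<Rightarrow> (real \<Rightarrow> 'a \<Rightarrow> real) \<Rightarrow> bool" where
  "standard_brownian_motion M \<F> B \<longleftrightarrow>
     prob_space M \<and> filtration (space M) \<F> \<and> (\<forall>t. subalgebra M (\<F> t)) \<and>
     (\<forall>t\<ge>0. B t \<in> borel_measurable (\<F> t)) \<and>
     (AE \<omega> in M. B 0 \<omega> = 0) \<and>
     (AE \<omega> in M. continuous_on {0..} (\<lambda>t. B t \<omega>)) \<and>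
     (\<forall>s t. 0 \<le> s \<and> s < t \<longrightarrow>
        distributed M lborel (\<lambda>\<omega>. B t \<omega> - B s \<omega>) (normal_density 0 (sqrt (t - s))) \<and>
        prob_space.indep_set M (sets (\<F> s))
          (sets (vimage_algebra (space M) (\<lambda>\<omega>. B t \<omega> - B s \<omega>) borel)))"

definition tendsto_in_probability ::
  "'a measure \<Rightarrow> (nat \<Rightarrow> 'a \<Rightarrow> real) \<Rightarrow> ('a \<Rightarrow> real) \<Rightarrow> bool" where
  "tendsto_in_probability M S I \<longleftrightarrow>
     (\<forall>n. S n \<in> borel_measurable M) \<and> I \<in> borel_measurable M \<and>
     (\<forall>e>0. (\<lambda>n. measure M {\<omega> \<in> space M. \<bar>S n \<omega> - I \<omega>\<bar> > e}) \<longlonglongrightarrow> 0)"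

text \<open>The \<open>n\<close>-th partition of \<open>[0, t]\<close> is \<open>p n 0 \<le> p n 1 \<le> \<dots> \<le> p n (N n)\<close>.\<close>

definition vanishing_partitions :: "real \<Rightarrow> (nat \<Rightarrow> nat) \<Rightarrow> (nat \<Rightarrow> nat \<Rightarrow> real) \<Rightarrow> bool" where
  "vanishing_partitions t N p \<longleftrightarrow>
     (\<forall>n. p n 0 = 0 \<and> p n (N n) = t \<and> (\<forall>i<N n. p n i \<le> p n (Suc i))) \<and>
     (\<forall>e>0. \<forall>\<^sub>F n in sequentially. \<forall>i<N n. p n (Suc i) - p n i < e)"

text \<open>The Ito integral \<open>\<integral>\<^sub>0\<^sup>t H dB\<close> of an adapted integrand with continuous paths is the limit in
  probability of left-endpoint Riemann sums along any partitions whose mesh tends to 0.\<close>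

definition has_ito_integral ::
  "'a measure \<Rightarrow> (real \<Rightarrow> 'a measure) \<Rightarrow> (real \<Rightarrow> 'a \<Rightarrow> real) \<Rightarrow> (real \<Rightarrow> 'a \<Rightarrow> real) \<Rightarrow> real
    \<Rightarrow> ('a \<Rightarrow> real) \<Rightarrow> bool" where
  "has_ito_integral M \<F> B H t I \<longleftrightarrow>
     (\<forall>s\<in>{0..t}. H s \<in> borel_measurable (\<F> s)) \<and>
     (AE \<omega> in M. continuous_on {0..t} (\<lambda>s. H s \<omega>)) \<and>
     (\<forall>N p. vanishing_partitions t N p \<longrightarrow>
        tendsto_in_probability M
          (\<lambda>n \<omega>. \<Sum>i<N n. H (p n i) \<omega> * (B (p n (Suc i)) \<omega> - B (p n i) \<omega>)) I)"

text \<open>\<open>X\<close> is a continuous adapted solution of \<open>dX = a(X) dt + b(X) dB\<close> with \<open>X\<^sub>0 = x\<close>.\<close>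

definition sde_solution ::
  "'a measure \<Rightarrow> (real \<Rightarrow> 'a measure) \<Rightarrow> (real \<Rightarrow> 'a \<Rightarrow> real) \<Rightarrow> (real \<Rightarrow> real) \<Rightarrow> (real \<Rightarrow> real)
    \<Rightarrow> real \<Rightarrow> (real \<Rightarrow> 'a \<Rightarrow> real) \<Rightarrow> bool" where
  "sde_solution M \<F> B a b x X \<longleftrightarrow>
     (\<forall>t\<ge>0. X t \<in> borel_measurable (\<F> t)) \<and>
     (AE \<omega> in M. continuous_on {0..} (\<lambda>t. X t \<omega>)) \<and>
     (AE \<omega> in M. X 0 \<omega> = x) \<and>
     (\<forall>t\<ge>0. \<exists>I. has_ito_integral M \<F> B (\<lambda>s \<omega>. b (X s \<omega>)) t I \<and>
        (AE \<omega> in M. X t \<omega> = X 0 \<omega> + integral {0..t} (\<lambda>s. a (X s \<omega>)) + I \<omega>))"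

section \<open>The entrepreneur economy\<close>

text \<open>Output per worker \<open>f(k) = F(k, 1)\<close>.\<close>

definition intensive :: "(real \<Rightarrow> real \<Rightarrow> real) \<Rightarrow> real \<Rightarrow> real" where
  "intensive F k = F k 1"

text \<open>The limit of \<open>f'\<close> at infinity exists because \<open>f'' < 0\<close>, but it may be \<open>-\<infinity>\<close>.\<close>

definition production_function :: "(real \<Rightarrow> real \<Rightarrow> real) \<Rightarrow> bool" where
  "production_function F \<longleftrightarrow>
     (\<forall>c>0. \<forall>k\<ge>0. \<forall>l\<ge>0. F (c * k) (c * l) = c * F k l) \<and>
     (\<forall>k>0. intensive F differentiable (at k)) \<and>
     (\<forall>k>0. deriv (intensive F) differentiable (at k)) \<and>
     continuous_on {0<..} (deriv (deriv (intensive F))) \<and>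
     (\<forall>k>0. deriv (deriv (intensive F)) k < 0) \<and>
     filterlim (deriv (intensive F)) at_top (at_right 0) \<and>
     (\<exists>l::ereal. l \<le> 0 \<and> ((\<lambda>k. ereal (deriv (intensive F) k)) \<longlongrightarrow> l) at_top)"

text \<open>The growth rate \<open>(1 - \<tau>) f'(K/L) - \<beta>\<close> of individual and aggregate capital in equilibrium.\<close>

definition growth_rate ::
  "(real \<Rightarrow> real \<Rightarrow> real) \<Rightarrow> real \<Rightarrow> real \<Rightarrow> real \<Rightarrow> real \<Rightarrow> real" where
  "growth_rate F L \<beta> \<tau> K = (1 - \<tau>) * deriv (intensive F) (K / L) - \<beta>"

definition aggregate_dynamics ::
  "(real \<Rightarrow> real \<Rightarrow> real) \<Rightarrow> real \<Rightarrow> real \<Rightarrow> real \<Rightarrow> (real \<Rightarrow> real) \<Rightarrow> bool" where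
  "aggregate_dynamics F L \<beta> \<tau> K \<longleftrightarrow>
     (\<forall>t\<ge>0. K t > 0 \<and>
        (K has_real_derivative growth_rate F L \<beta> \<tau> (K t) * K t) (at t within {0..}))"

definition steady_state ::
  "(real \<Rightarrow> real \<Rightarrow> real) \<Rightarrow> real \<Rightarrow> real \<Rightarrow> real \<Rightarrow> real \<Rightarrow> bool" where
  "steady_state F L \<beta> \<tau> K \<longleftrightarrow> aggregate_dynamics F L \<beta> \<tau> (\<lambda>_. K)"

text \<open>Capital of an entrepreneur who starts with \<open>x\<close>, as a function of the time since then, when
  aggregate capital is constant at \<open>K\<close>.\<close>

definition capital_process ::
  "'a measure \<Rightarrow> (real \<Rightarrow> 'a measure) \<Rightarrow> (real \<Rightarrow> 'a \<Rightarrow> real) \<Rightarrow> (real \<Rightarrow> real \<Rightarrow> real)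
    \<Rightarrow> real \<Rightarrow> real \<Rightarrow> real \<Rightarrow> real \<Rightarrow> real \<Rightarrow> real \<Rightarrow> (real \<Rightarrow> 'a \<Rightarrow> real) \<Rightarrow> bool" where
  "capital_process M \<F> B F L \<beta> \<sigma> \<tau> K x X \<longleftrightarrow>
     sde_solution M \<F> B (\<lambda>k. growth_rate F L \<beta> \<tau> K * k) (\<lambda>k. (1 - \<tau>) * \<sigma> * k) x X"

text \<open>Exit at Poisson rate \<open>\<lambda>\<close>: the time to exit is exponential and independent of the shocks.\<close>

definition exit_time ::
  "'a measure \<Rightarrow> (real \<Rightarrow> 'a measure) \<Rightarrow> real \<Rightarrow> ('a \<Rightarrow> real) \<Rightarrow> bool" where
  "exit_time M \<F> lam T \<longleftrightarrow>
     distributed M lborel T (exponential_density lam) \<and>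
     (\<forall>t\<ge>0. prob_space.indep_set M (sets (\<F> t)) (sets (vimage_algebra (space M) T borel)))"

text \<open>The probability of being still active after time \<open>t\<close> with capital in \<open>A\<close>.\<close>

definition active_in ::
  "'a measure \<Rightarrow> ('a \<Rightarrow> real) \<Rightarrow> (real \<Rightarrow> 'a \<Rightarrow> real) \<Rightarrow> real \<Rightarrow> real set \<Rightarrow> ennreal" where
  "active_in M T X t A = emeasure M {\<omega> \<in> space M. t < T \<omega> \<and> X t \<omega> \<in> A}"

text \<open>The continuum of entrepreneurs has mass 1 and idiosyncratic shocks. Starting from the
  cross-section \<open>D\<close>, the cross-section at time \<open>t\<close> consists of the initial entrepreneurs who have not
  exited by \<open>t\<close> and of those who entered at some \<open>u \<in> [0, t]\<close> (flow \<open>\<lambda> du\<close>, equal to the flow of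
  exits) and have not exited by \<open>t\<close>. Exit is independent of capital, so exiting entrepreneurs hold on
  average the population mean, which is also the aggregate capital \<open>K\<close>. The process started at \<open>x\<close>
  is \<open>X x\<close>; idiosyncratic shocks of different entrepreneurs are independent copies of \<open>(B, T)\<close>, and
  only their law enters the cross-section.\<close>

definition stationary_wealth_distribution ::
  "'a measure \<Rightarrow> (real \<Rightarrow> 'a measure) \<Rightarrow> (real \<Rightarrow> 'a \<Rightarrow> real) \<Rightarrow> ('a \<Rightarrow> real)
    \<Rightarrow> (real \<Rightarrow> real \<Rightarrow> real) \<Rightarrow> real \<Rightarrow> real \<Rightarrow> real \<Rightarrow> real \<Rightarrow> real \<Rightarrow> real measure \<Rightarrow> bool" where
  "stationary_wealth_distribution M \<F> B T F L \<beta> \<sigma> lam \<tau> D \<longleftrightarrow>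
     prob_space D \<and> sets D = sets borel \<and> emeasure D {0<..} = 1 \<and>
     integrable D (\<lambda>k. k) \<and>
     (\<exists>K X. K = (\<integral>k. k \<partial>D) \<and>
        steady_state F L \<beta> \<tau> K \<and>
        (\<forall>x>0. capital_process M \<F> B F L \<beta> \<sigma> \<tau> K x (X x)) \<and>
        (\<forall>t\<ge>0. \<forall>A\<in>sets borel.
           emeasure D A =
             (\<integral>\<^sup>+x. active_in M T (X x) t A \<partial>D) +
             (\<integral>\<^sup>+u\<in>{0..t}. ennreal lam * active_in M T (X K) (t - u) A \<partial>lborel)))"

section \<open>Double Pareto distributions\<close>

definition double_pareto_density :: "real \<Rightarrow> real \<Rightarrow> real \<Rightarrow> real \<Rightarrow> real" where
  "double_pareto_density x\<^sub>0 \<alpha> \<kappa> x =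
     (if x \<le> 0 then 0
      else if x < x\<^sub>0 then \<alpha> * \<kappa> / (\<alpha> + \<kappa>) * (1 / x\<^sub>0) * (x / x\<^sub>0) powr (\<kappa> - 1)
      else \<alpha> * \<kappa> / (\<alpha> + \<kappa>) * (1 / x\<^sub>0) * (x / x\<^sub>0) powr (- \<alpha> - 1))"

text \<open>\<open>D\<close> is double Pareto with Pareto exponent \<open>\<alpha>\<close>.\<close>

definition double_pareto :: "real measure \<Rightarrow> real \<Rightarrow> bool" where
  "double_pareto D \<alpha> \<longleftrightarrow>
     \<alpha> > 0 \<and> (\<exists>x\<^sub>0>0. \<exists>\<kappa>>0. D = density lborel (\<lambda>x. ennreal (double_pareto_density x\<^sub>0 \<alpha> \<kappa> x)))"

end

theory Submission
  imports Defs
begin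

text \<open>In a steady state the drift of individual capital vanishes, so capital solves
  \<open>dX = s X dB\<close> with \<open>s = (1 - \<tau>) \<sigma>\<close>. The exponential \<open>x exp (s B\<^sub>t - s\<^sup>2 t / 2)\<close> is a solution, and it
  is the only one. Since exit is independent of the shocks, the stationarity condition then reads
  \<open>D = e\<^bsup>-lam t\<^esup> D P\<^sub>t + \<integral>\<^sub>0\<^sup>t lam e\<^bsup>-lam u\<^esup> P\<^sub>u(K, \<cdot>) du\<close> with the lognormal semigroup \<open>P\<close>. Letting
  \<open>t \<rightarrow> \<infinity>\<close> identifies \<open>D\<close> as the law of the solution from \<open>K\<close> at an independent exponential time, and
  the semigroup property shows that this law is indeed stationary. Its logarithm has a rational
  characteristic function, that of an asymmetric Laplace distribution, so \<open>D\<close> is double Pareto.\<close>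

text \<open>The definition of stationarity admits an arbitrary family of solutions, and a solution
  is known only through limits in probability of Riemann sums. The law of capital at a date is
  therefore accessible only after uniqueness is proved from these sums. The tool is an orthogonality
  relation for sums of adapted factors times centred functions of Brownian increments, a discrete
  Ito isometry. It serves twice: for the error of the Riemann sums of the exponential, and for the
  difference of two solutions. The entry level and the mean of \<open>D\<close> have to be the same
  number \<open>K\<close>. Strict decrease of the marginal product determines \<open>K\<close>, and
  the absence of drift keeps mean capital at the entry level, so the candidate law has mean
  \<open>K\<close> as required. The exponents can be read off from two conditions. Mean one of
  \<open>exp Y\<close>, where \<open>Y\<close> is log wealth relative to \<open>K\<close>, means
  \<open>\<alpha> * \<kappa> = (\<alpha> - 1) * (\<kappa> + 1)\<close>, that is
  \<open>\<alpha> - \<kappa> = 1\<close>; the ratio of exit rate to variance fixes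
  \<open>\<alpha> * \<kappa>\<close>. The stated exponent is the positive root of the resulting
  quadratic.\<close>

lemma (in prob_space) indep_var_subalgebra:
  assumes G: "subalgebra M G"
    and indep: "indep_set (sets G) (sets (vimage_algebra (space M) W borel))"
    and H: "H \<in> measurable G N" and W: "W \<in> borel_measurable M"
  shows "indep_var N H borel W"
  unfolding indep_var_eq
proof (intro conjI)
  show "H \<in> measurable M N" by (rule measurable_from_subalg[OF G H])
  have "{H -` A \<inter> space M |A. A \<in> sets N} \<subseteq> sets G"
    using H G by (auto simp: subalgebra_def measurable_def)
  then have "sigma_sets (space M) {H -` A \<inter> space M |A. A \<in> sets N} \<subseteq> sets G"
    using sets.sigma_sets_subset[of _ G] G by (simp add: subalgebra_def)
  with indep show "indep_set (sigma_sets (space M) {H -` A \<inter> space M |A. A \<in> sets N})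
      (sigma_sets (space M) {W -` A \<inter> space M |A. A \<in> sets borel})"
    unfolding indep_sets2_eq sets_vimage_algebra by blast
qed (use W in simp)

abbreviation std_normal :: "real measure" where "std_normal \<equiv> std_normal_distribution"

lemma abs_mult_le_sum_squares: "\<bar>a * b\<bar> \<le> a\<^sup>2 + b\<^sup>2" for a b :: real
proof -
  have "2 * \<bar>a * b\<bar> \<le> a\<^sup>2 + b\<^sup>2"
    using sum_squares_bound[of "\<bar>a\<bar>" "\<bar>b\<bar>"] by (simp add: abs_mult)
  then show ?thesis
    using abs_ge_zero[of "a * b"] by linarith
qed

lemma distr_lborel: "distr N lborel f = distr N borel f"
  by (rule distr_cong) simp_all

lemma emeasure_distr_nn_integral:
  assumes [measurable]: "f \<in> measurable M N" "A \<in> sets N"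
  shows "emeasure (distr M N f) A = (\<integral>\<^sup>+x. indicator A (f x) \<partial>M)"
proof -
  have "emeasure (distr M N f) A = (\<integral>\<^sup>+y. indicator A y \<partial>distr M N f)" by simp
  then show ?thesis by (simp only: nn_integral_distr borel_measurable_indicator assms sets_distr)
qed

lemma prob_space_std_normal: "prob_space std_normal"
  by (rule prob_space_normal_density) simp

section \<open>Brownian increments\<close>

locale brownian_motion =
  fixes M :: "'a measure" and \<F> :: "real \<Rightarrow> 'a measure" and B :: "real \<Rightarrow> 'a \<Rightarrow> real"
  assumes brownian: "standard_brownian_motion M \<F> B"

sublocale brownian_motion \<subseteq> prob_space M
  using brownian by (simp add: standard_brownian_motion_def)

sublocale brownian_motion \<subseteq> filtration "space M" \<F>
  using brownian by (simp add: standard_brownian_motion_def)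

context brownian_motion
begin

lemma subalgebra_filtration: "subalgebra M (\<F> t)"
  using brownian by (simp add: standard_brownian_motion_def)

lemma measurable_filtration_mono:
  "f \<in> measurable (\<F> s) N \<Longrightarrow> s \<le> t \<Longrightarrow> f \<in> measurable (\<F> t) N"
  using sets_F_mono[of s t] by (auto simp: measurable_def space_F)

lemma measurable_from_filtration: "f \<in> measurable (\<F> s) N \<Longrightarrow> f \<in> measurable M N"
  by (rule measurable_from_subalg[OF subalgebra_filtration])

lemma brownian_adapted: "0 \<le> t \<Longrightarrow> B t \<in> borel_measurable (\<F> t)"
  using brownian by (simp add: standard_brownian_motion_def)

lemma brownian_measurable: "0 \<le> t \<Longrightarrow> B t \<in> borel_measurable M"
  by (rule measurable_from_filtration[OF brownian_adapted])

lemma increment_measurable: "0 \<le> s \<Longrightarrow> s \<le> t \<Longrightarrow> (\<lambda>\<omega>. B t \<omega> - B s \<omega>) \<in> borel_measurable M"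
  using brownian_measurable[of s] brownian_measurable[of t] by simp

lemma brownian_0: "AE \<omega> in M. B 0 \<omega> = 0"
  using brownian by (simp add: standard_brownian_motion_def)

lemma brownian_continuous: "AE \<omega> in M. continuous_on {0..} (\<lambda>t. B t \<omega>)"
  using brownian by (simp add: standard_brownian_motion_def)

lemma increment_indep:
  assumes "0 \<le> s" "s < t" "H \<in> measurable (\<F> s) N"
  shows "indep_var N H borel (\<lambda>\<omega>. B t \<omega> - B s \<omega>)"
  using brownian assms increment_measurable[of s t]
  by (intro indep_var_subalgebra[OF subalgebra_filtration[of s]])
     (auto simp: standard_brownian_motion_def)

text \<open>Writing the increment as a scaled standard normal also covers \<open>s = t\<close>,
  where a normal density with standard deviation zero would not describe the point mass at
  0.\<close>

lemma increment_distr: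
  assumes "0 \<le> s" "s \<le> t"
  shows "distr M borel (\<lambda>\<omega>. B t \<omega> - B s \<omega>) = distr std_normal borel (\<lambda>z. sqrt (t - s) * z)"
proof -
  interpret N: prob_space std_normal
    by (rule prob_space_std_normal)
  consider "s = t" | "s < t" using assms by linarith
  then show ?thesis
  proof cases
    case 1
    then show ?thesis using distr_const[of 0 borel] N.distr_const[of 0 borel] by simp
  next
    case 2
    then have "distributed M lborel (\<lambda>\<omega>. B t \<omega> - B s \<omega>) (normal_density 0 (sqrt (t - s)))"
      using brownian assms by (simp add: standard_brownian_motion_def)
    then have "distr M lborel (\<lambda>\<omega>. B t \<omega> - B s \<omega>) = density lborel (normal_density 0 (sqrt (t - s)))"
      by (rule distributed_distr_eq_density)
    moreover have "distributed std_normal lborel (\<lambda>z. z) std_normal_density"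
      by (auto simp: distributed_def intro!: measure_eqI simp: emeasure_distr)
    from N.normal_density_affine[OF this, of "sqrt (t - s)" 0] 2
    have "distr std_normal lborel (\<lambda>z. sqrt (t - s) * z) = density lborel (normal_density 0 (sqrt (t - s)))"
      by (auto dest: distributed_distr_eq_density)
    ultimately have "distr M lborel (\<lambda>\<omega>. B t \<omega> - B s \<omega>) = distr std_normal lborel (\<lambda>z. sqrt (t - s) * z)"
      by simp
    then show ?thesis by (simp only: distr_lborel)
  qed
qed

lemma increment_integral:
  fixes g :: "real \<Rightarrow> real"
  assumes "0 \<le> s" "s \<le> t" and g: "g \<in> borel_measurable borel"
  shows "(\<integral>\<omega>. g (B t \<omega> - B s \<omega>) \<partial>M) = (\<integral>z. g (sqrt (t - s) * z) \<partial>std_normal)"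
    and "integrable M (\<lambda>\<omega>. g (B t \<omega> - B s \<omega>)) \<longleftrightarrow> integrable std_normal (\<lambda>z. g (sqrt (t - s) * z))"
proof -
  note W = increment_measurable[OF assms(1,2)]
  have m: "(\<lambda>z. sqrt (t - s) * z) \<in> borel_measurable std_normal" by simp
  show "(\<integral>\<omega>. g (B t \<omega> - B s \<omega>) \<partial>M) = (\<integral>z. g (sqrt (t - s) * z) \<partial>std_normal)"
    and "integrable M (\<lambda>\<omega>. g (B t \<omega> - B s \<omega>)) \<longleftrightarrow> integrable std_normal (\<lambda>z. g (sqrt (t - s) * z))"
    unfolding integral_distr[OF W g, symmetric] integral_distr[OF m g, symmetric]
      integrable_distr_eq[OF W g, symmetric] integrable_distr_eq[OF m g, symmetric]
      increment_distr[OF assms(1,2)]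
    by (rule refl)+
qed

text \<open>Independence of increments is only given for \<open>s < t\<close>; a degenerate step contributes nothing
  because a centred constant vanishes.\<close>

lemma orthogonal_sum_second_moment:
  fixes H :: "nat \<Rightarrow> 'a \<Rightarrow> real" and g :: "nat \<Rightarrow> real \<Rightarrow> real" and p :: "nat \<Rightarrow> real"
  assumes p: "0 \<le> p 0" "\<And>i. i < n \<Longrightarrow> p i \<le> p (Suc i)"
    and H: "\<And>i. i < n \<Longrightarrow> H i \<in> borel_measurable (\<F> (p i))"
    and H2: "\<And>i. i < n \<Longrightarrow> integrable M (\<lambda>\<omega>. (H i \<omega>)\<^sup>2)"
    and g[measurable]: "\<And>i. g i \<in> borel_measurable borel"
    and g2: "\<And>i. i < n \<Longrightarrow> integrable M (\<lambda>\<omega>. (g i (B (p (Suc i)) \<omega> - B (p i) \<omega>))\<^sup>2)"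
    and g0: "\<And>i. i < n \<Longrightarrow> (\<integral>\<omega>. g i (B (p (Suc i)) \<omega> - B (p i) \<omega>) \<partial>M) = 0"
  defines "S \<equiv> \<lambda>m \<omega>. \<Sum>i<m. H i \<omega> * g i (B (p (Suc i)) \<omega> - B (p i) \<omega>)"
  shows "integrable M (\<lambda>\<omega>. (S n \<omega>)\<^sup>2)"
    and "(\<integral>\<omega>. (S n \<omega>)\<^sup>2 \<partial>M) =
      (\<Sum>i<n. (\<integral>\<omega>. (H i \<omega>)\<^sup>2 \<partial>M) * (\<integral>\<omega>. (g i (B (p (Suc i)) \<omega> - B (p i) \<omega>))\<^sup>2 \<partial>M))"
proof -
  have p0: "0 \<le> p m" if "m \<le> n" for m
    using that by (induction m) (use p in \<open>auto intro: order_trans\<close>)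
  \<comment> \<open>Adaptedness of the partial sum is carried through the induction: it makes
    \<open>S m * H m\<close> known at time \<open>p m\<close>, hence independent of the next
    increment.\<close>
  have "m \<le> n \<Longrightarrow> S m \<in> borel_measurable (\<F> (p m)) \<and> integrable M (\<lambda>\<omega>. (S m \<omega>)\<^sup>2) \<and>
     (\<integral>\<omega>. (S m \<omega>)\<^sup>2 \<partial>M) =
      (\<Sum>i<m. (\<integral>\<omega>. (H i \<omega>)\<^sup>2 \<partial>M) * (\<integral>\<omega>. (g i (B (p (Suc i)) \<omega> - B (p i) \<omega>))\<^sup>2 \<partial>M))" for m
  proof (induction m)
    case 0
    then show ?case by (simp add: S_def)
  next
    case (Suc m)
    then have m: "m < n" by simp
    define W where "W = (\<lambda>\<omega>. B (p (Suc m)) \<omega> - B (p m) \<omega>)"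
    have IH: "S m \<in> borel_measurable (\<F> (p m))" "integrable M (\<lambda>\<omega>. (S m \<omega>)\<^sup>2)"
      "(\<integral>\<omega>. (S m \<omega>)\<^sup>2 \<partial>M) =
      (\<Sum>i<m. (\<integral>\<omega>. (H i \<omega>)\<^sup>2 \<partial>M) * (\<integral>\<omega>. (g i (B (p (Suc i)) \<omega> - B (p i) \<omega>))\<^sup>2 \<partial>M))"
      using Suc by auto
    have le: "p m \<le> p (Suc m)" using p(2)[OF m] .
    have pm: "0 \<le> p m" using p0 m by simp
    have Wm[measurable]: "W \<in> borel_measurable M"
      unfolding W_def by (rule increment_measurable[OF pm le])
    have Sm[measurable]: "S m \<in> borel_measurable M" by (rule measurable_from_filtration[OF IH(1)])
    have Hm[measurable]: "H m \<in> borel_measurable M" by (rule measurable_from_filtration[OF H[OF m]])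
    have S_Suc: "S (Suc m) = (\<lambda>\<omega>. S m \<omega> + H m \<omega> * g m (W \<omega>))"
      by (simp add: S_def W_def)
    have adapted: "S (Suc m) \<in> borel_measurable (\<F> (p (Suc m)))"
    proof -
      have [measurable]: "S m \<in> borel_measurable (\<F> (p (Suc m)))" "H m \<in> borel_measurable (\<F> (p (Suc m)))"
        "B (p m) \<in> borel_measurable (\<F> (p (Suc m)))" "B (p (Suc m)) \<in> borel_measurable (\<F> (p (Suc m)))"
        using measurable_filtration_mono[OF IH(1) le] measurable_filtration_mono[OF H[OF m] le]
          measurable_filtration_mono[OF brownian_adapted[OF pm] le] brownian_adapted[of "p (Suc m)"] pm le
        by auto
      show ?thesis unfolding S_Suc W_def by measurable
    qed
    have g2W: "integrable M (\<lambda>\<omega>. (g m (W \<omega>))\<^sup>2)" using g2[OF m] by (simp add: W_def)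
    have g1W: "integrable M (\<lambda>\<omega>. g m (W \<omega>))"
      by (rule square_integrable_imp_integrable[OF _ g2W]) measurable
    \<comment> \<open>The expectation of the cross term factors only once \<open>S m * H m\<close>
      is known to be integrable; this follows from square integrability of the two factors.\<close>
    have SH1: "integrable M (\<lambda>\<omega>. S m \<omega> * H m \<omega>)"
    proof (rule Bochner_Integration.integrable_bound)
      show "integrable M (\<lambda>\<omega>. (S m \<omega>)\<^sup>2 + (H m \<omega>)\<^sup>2)" using IH(2) H2[OF m] by simp
      show "AE \<omega> in M. norm (S m \<omega> * H m \<omega>) \<le> norm ((S m \<omega>)\<^sup>2 + (H m \<omega>)\<^sup>2)"
      proof (intro AE_I2)
        fix \<omega>
        show "norm (S m \<omega> * H m \<omega>) \<le> norm ((S m \<omega>)\<^sup>2 + (H m \<omega>)\<^sup>2)"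
          using abs_mult_le_sum_squares[of "S m \<omega>" "H m \<omega>"] by simp
      qed
    qed measurable
    have "integrable M (\<lambda>\<omega>. (H m \<omega>)\<^sup>2 * (g m (W \<omega>))\<^sup>2) \<and>
      (\<integral>\<omega>. (H m \<omega>)\<^sup>2 * (g m (W \<omega>))\<^sup>2 \<partial>M) = (\<integral>\<omega>. (H m \<omega>)\<^sup>2 \<partial>M) * (\<integral>\<omega>. (g m (W \<omega>))\<^sup>2 \<partial>M) \<and>
      integrable M (\<lambda>\<omega>. S m \<omega> * H m \<omega> * g m (W \<omega>)) \<and>
      (\<integral>\<omega>. S m \<omega> * H m \<omega> * g m (W \<omega>) \<partial>M) = 0"
    proof (cases "p m = p (Suc m)")
      case True
      then have W0: "W = (\<lambda>_. 0)" by (simp add: W_def)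
      with g0[OF m] W0 True have "g m 0 = 0" by (simp add: prob_space)
      then show ?thesis using W0 by simp
    next
      case False
      then have lt: "p m < p (Suc m)" using le by simp
      have "(\<lambda>\<omega>. (H m \<omega>)\<^sup>2) \<in> borel_measurable (\<F> (p m))"
        using H[OF m] by simp
      from increment_indep[OF pm lt this]
      have "indep_var borel (id \<circ> (\<lambda>\<omega>. (H m \<omega>)\<^sup>2)) borel ((\<lambda>x. (g m x)\<^sup>2) \<circ> W)"
        unfolding W_def by (rule indep_var_compose) measurable
      then have i1: "indep_var borel (\<lambda>\<omega>. (H m \<omega>)\<^sup>2) borel (\<lambda>\<omega>. (g m (W \<omega>))\<^sup>2)"
        by (simp add: comp_def)
      have "(\<lambda>\<omega>. S m \<omega> * H m \<omega>) \<in> borel_measurable (\<F> (p m))"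
        using H[OF m] IH(1) by simp
      from increment_indep[OF pm lt this]
      have "indep_var borel (id \<circ> (\<lambda>\<omega>. S m \<omega> * H m \<omega>)) borel (g m \<circ> W)"
        unfolding W_def by (rule indep_var_compose) measurable
      then have i2: "indep_var borel (\<lambda>\<omega>. S m \<omega> * H m \<omega>) borel (\<lambda>\<omega>. g m (W \<omega>))"
        by (simp add: comp_def)
      show ?thesis
        using indep_var_integrable[OF i1 H2[OF m] g2W] indep_var_lebesgue_integral[OF i1 H2[OF m] g2W]
          indep_var_integrable[OF i2 SH1 g1W] indep_var_lebesgue_integral[OF i2 SH1 g1W] g0[OF m]
        by (simp add: W_def)
    qed
    note T = this
    have eq: "(\<lambda>\<omega>. (S (Suc m) \<omega>)\<^sup>2) = (\<lambda>\<omega>. (S m \<omega>)\<^sup>2 + (2 * (S m \<omega> * H m \<omega> * g m (W \<omega>)) +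
        (H m \<omega>)\<^sup>2 * (g m (W \<omega>))\<^sup>2))"
      by (simp add: S_Suc fun_eq_iff power2_sum power_mult_distrib algebra_simps)
    show ?case
      unfolding eq using adapted T IH by (simp add: W_def)
  qed
  from this[of n] show "integrable M (\<lambda>\<omega>. (S n \<omega>)\<^sup>2)"
    and "(\<integral>\<omega>. (S n \<omega>)\<^sup>2 \<partial>M) =
      (\<Sum>i<n. (\<integral>\<omega>. (H i \<omega>)\<^sup>2 \<partial>M) * (\<integral>\<omega>. (g i (B (p (Suc i)) \<omega> - B (p i) \<omega>))\<^sup>2 \<partial>M))"
    by simp_all
qed

end

section \<open>Geometric Brownian motion\<close>

text \<open>Completing the square: the weight \<open>exp (c * z)\<close> turns the standard normal
  density into \<open>exp (c\<^sup>2 / 2)\<close> times the normal density with mean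
  \<open>c\<close>, so both integrals are moments of a shifted normal.\<close>

lemma std_normal_exp:
  shows "integrable std_normal (\<lambda>z. exp (c * z))" "(\<integral>z. exp (c * z) \<partial>std_normal) = exp (c\<^sup>2 / 2)"
    and "integrable std_normal (\<lambda>z. z * exp (c * z))"
    and "(\<integral>z. z * exp (c * z) \<partial>std_normal) = c * exp (c\<^sup>2 / 2)"
proof -
  have eq: "std_normal_density z * exp (c * z) = exp (c\<^sup>2 / 2) * normal_density c 1 z" for z
    unfolding normal_density_def
    by (simp add: mult_exp_exp power2_eq_square algebra_simps diff_divide_distrib add_divide_distrib)
  have eq': "std_normal_density z * (z * exp (c * z)) = exp (c\<^sup>2 / 2) * (normal_density c 1 z * z)" for z
    using arg_cong[OF eq[of z], of "\<lambda>y. y * z"] by (simp add: ac_simps)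
  show "integrable std_normal (\<lambda>z. exp (c * z))" "(\<integral>z. exp (c * z) \<partial>std_normal) = exp (c\<^sup>2 / 2)"
    by (simp_all add: integrable_real_density integral_real_density eq)
  show "integrable std_normal (\<lambda>z. z * exp (c * z))"
    and "(\<integral>z. z * exp (c * z) \<partial>std_normal) = c * exp (c\<^sup>2 / 2)"
    by (simp_all add: integrable_real_density integral_real_density eq' integral_normal_moment_nz_1
        integrable_normal_moment_nz_1)
qed

lemma std_normal_power:
  shows "integrable std_normal (\<lambda>z. z)" "(\<integral>z. z \<partial>std_normal) = 0"
    and "integrable std_normal (\<lambda>z. z\<^sup>2)" "(\<integral>z. z\<^sup>2 \<partial>std_normal) = 1"
  using integrable_std_normal_distribution_moment[of 1] integrable_std_normal_distribution_moment[of 2]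
    integral_std_normal_distribution_moment_odd[of 1] std_normal_distribution_even_moments(1)[of 1]
  by simp_all

lemma std_normal_const: "integrable std_normal (\<lambda>z. k :: real)" "(\<integral>z. (k :: real) \<partial>std_normal) = k"
proof -
  interpret prob_space std_normal by (rule prob_space_std_normal)
  show "integrable std_normal (\<lambda>z. k :: real)" "(\<integral>z. (k :: real) \<partial>std_normal) = k"
    using prob_space by simp_all
qed

text \<open>With \<open>c = s * sqrt d\<close>, \<open>\<eta> c\<close> is the relative error of one
  Riemann step of length \<open>d\<close>. Its second moment is the exponential series in
  \<open>c\<^sup>2\<close> without its first two terms, hence of order
  \<open>d\<^sup>2\<close>.\<close>

lemma std_normal_exp_remainder:
  defines "\<eta> \<equiv> \<lambda>c z :: real. exp (c * z - c\<^sup>2 / 2) - 1 - c * z"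
  shows "(\<integral>z. \<eta> c z \<partial>std_normal) = 0"
    and "integrable std_normal (\<lambda>z. (\<eta> c z)\<^sup>2)"
    and "(\<integral>z. (\<eta> c z)\<^sup>2 \<partial>std_normal) = exp (c\<^sup>2) - 1 - c\<^sup>2"
proof -
  note facts = std_normal_exp std_normal_power std_normal_const
  have 1: "\<eta> c = (\<lambda>z. exp (- (c\<^sup>2 / 2)) * exp (c * z) + (- 1 + (- c) * z))"
    by (simp add: \<eta>_def fun_eq_iff mult_exp_exp)
  have I1: "integrable std_normal (\<lambda>z. exp (- (c\<^sup>2 / 2)) * exp (c * z))"
    "integrable std_normal (\<lambda>z. - 1 :: real)" "integrable std_normal (\<lambda>z. (- c) * z)"
    by (intro integrable_mult_right facts)+
  have "(\<integral>z. \<eta> c z \<partial>std_normal) = exp (- (c\<^sup>2 / 2)) * exp (c\<^sup>2 / 2) - 1"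
    unfolding 1
    by (simp only: Bochner_Integration.integral_add Bochner_Integration.integrable_add I1
        integral_mult_right_zero facts)
  then show "(\<integral>z. \<eta> c z \<partial>std_normal) = 0" by (simp add: mult_exp_exp)
  have 2: "(\<lambda>z. (\<eta> c z)\<^sup>2) = (\<lambda>z. exp (- (c\<^sup>2)) * exp ((2 * c) * z) +
      (- 2 * exp (- (c\<^sup>2 / 2)) * exp (c * z) + (- 2 * c * exp (- (c\<^sup>2 / 2)) * (z * exp (c * z)) +
        (1 + (2 * c * z + c\<^sup>2 * z\<^sup>2)))))"
  proof
    fix z
    have "exp (c * z - c\<^sup>2 / 2) * exp (c * z - c\<^sup>2 / 2) = exp (- (c\<^sup>2)) * exp ((2 * c) * z)"
      by (simp add: mult_exp_exp algebra_simps)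
    moreover have "exp (c * z - c\<^sup>2 / 2) = exp (- (c\<^sup>2 / 2)) * exp (c * z)"
      by (simp add: mult_exp_exp)
    ultimately show "(\<eta> c z)\<^sup>2 = exp (- (c\<^sup>2)) * exp ((2 * c) * z) +
      (- 2 * exp (- (c\<^sup>2 / 2)) * exp (c * z) + (- 2 * c * exp (- (c\<^sup>2 / 2)) * (z * exp (c * z)) +
        (1 + (2 * c * z + c\<^sup>2 * z\<^sup>2))))"
      unfolding \<eta>_def power2_eq_square by algebra
  qed
  have I: "integrable std_normal (\<lambda>z. exp (- (c\<^sup>2)) * exp ((2 * c) * z))"
    "integrable std_normal (\<lambda>z. - 2 * exp (- (c\<^sup>2 / 2)) * exp (c * z))"
    "integrable std_normal (\<lambda>z. - 2 * c * exp (- (c\<^sup>2 / 2)) * (z * exp (c * z)))"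
    "integrable std_normal (\<lambda>z. 1 :: real)" "integrable std_normal (\<lambda>z. 2 * c * z)"
    "integrable std_normal (\<lambda>z. c\<^sup>2 * z\<^sup>2)"
    by (intro integrable_mult_right facts)+
  show "integrable std_normal (\<lambda>z. (\<eta> c z)\<^sup>2)"
    unfolding 2 by (intro Bochner_Integration.integrable_add I)
  have "exp (- (c\<^sup>2)) * exp ((2 * c)\<^sup>2 / 2) = exp (c\<^sup>2)"
    "exp (- (c\<^sup>2 / 2)) * exp (c\<^sup>2 / 2) = 1"
    by (simp_all add: mult_exp_exp power_mult_distrib)
  moreover have "(\<integral>z. (\<eta> c z)\<^sup>2 \<partial>std_normal) = exp (- (c\<^sup>2)) * exp ((2 * c)\<^sup>2 / 2) +
      (- 2 * exp (- (c\<^sup>2 / 2)) * exp (c\<^sup>2 / 2) +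
        (- 2 * c * exp (- (c\<^sup>2 / 2)) * (c * exp (c\<^sup>2 / 2)) + (1 + (2 * c * 0 + c\<^sup>2 * 1))))"
    unfolding 2
    by (simp only: Bochner_Integration.integral_add Bochner_Integration.integrable_add I
        integral_mult_right_zero facts)
  moreover have "- 2 * c * exp (- (c\<^sup>2 / 2)) * (c * exp (c\<^sup>2 / 2)) =
      - 2 * c\<^sup>2 * (exp (- (c\<^sup>2 / 2)) * exp (c\<^sup>2 / 2))"
    by (simp add: power2_eq_square)
  ultimately show "(\<integral>z. (\<eta> c z)\<^sup>2 \<partial>std_normal) = exp (c\<^sup>2) - 1 - c\<^sup>2"
    by simp
qed

text \<open>A rearrangement of \<open>1 - y \<le> exp (- y)\<close>. In the product on the right one
  factor is summed over the partition while the other is made small by the mesh.\<close>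

lemma exp_remainder_le: "exp y - 1 - y \<le> y * (exp y - 1)" for y :: real
proof -
  have "(1 - y) * exp y \<le> exp (- y) * exp y"
    using exp_ge_add_one_self[of "- y"] by (intro mult_right_mono) auto
  then show ?thesis by (simp add: mult_exp_exp algebra_simps)
qed

lemma vanishing_partitions_mono:
  assumes "vanishing_partitions t N p" "i \<le> j" "j \<le> N n"
  shows "p n i \<le> p n j"
  using assms(2,3)
proof (induction j rule: dec_induct)
  case (step k)
  then show ?case
    using assms(1) by (auto simp: vanishing_partitions_def intro: order_trans)
qed simp

lemma vanishing_partitions_bounds:
  assumes "vanishing_partitions t N p" "i \<le> N n"
  shows "0 \<le> p n i" "p n i \<le> t"
  using vanishing_partitions_mono[OF assms(1), of 0 i n] vanishing_partitions_mono[OF assms(1), of i "N n" n]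
    assms by (auto simp: vanishing_partitions_def)

lemma vanishing_partitions_sum:
  fixes f :: "real \<Rightarrow> real"
  assumes "vanishing_partitions t N p"
  shows "(\<Sum>i<N n. f (p n (Suc i)) - f (p n i)) = f t - f 0"
  using assms by (simp add: sum_lessThan_telescope[of "\<lambda>i. f (p n i)"] vanishing_partitions_def)

context brownian_motion
begin

text \<open>The stochastic exponential of \<open>s B\<close>, started at \<open>x\<close>: the term
  \<open>s\<^sup>2 / 2 * t\<close> compensates the quadratic variation and removes the
  drift.\<close>

definition geometric :: "real \<Rightarrow> real \<Rightarrow> real \<Rightarrow> 'a \<Rightarrow> real" where
  "geometric s x t \<omega> = x * exp (s * B t \<omega> - s\<^sup>2 / 2 * t)"

lemma geometric_adapted: "0 \<le> t \<Longrightarrow> geometric s x t \<in> borel_measurable (\<F> t)"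
  using brownian_adapted[of t] unfolding geometric_def by measurable

lemma geometric_measurable: "0 \<le> t \<Longrightarrow> geometric s x t \<in> borel_measurable M"
  by (rule measurable_from_filtration[OF geometric_adapted])

lemma geometric_0: "AE \<omega> in M. geometric s x 0 \<omega> = x"
  using brownian_0 by eventually_elim (simp add: geometric_def)

lemma geometric_continuous: "AE \<omega> in M. continuous_on {0..} (\<lambda>t. geometric s x t \<omega>)"
  using brownian_continuous
  by eventually_elim (unfold geometric_def, intro continuous_intros)

text \<open>\<open>B 0\<close> vanishes only almost surely, and laws are known for increments, so
  \<open>B t\<close> is replaced by the increment from time 0.\<close>

lemma geometric_eq_increment:
  "AE \<omega> in M. geometric s x t \<omega> = x * exp (s * (B t \<omega> - B 0 \<omega>) - s\<^sup>2 / 2 * t)"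
  using brownian_0 by eventually_elim (simp add: geometric_def)

text \<open>The Gaussian factor contributes \<open>exp (2 * s\<^sup>2 * t)\<close>, of which the
  squared compensator takes back \<open>exp (s\<^sup>2 * t)\<close>.\<close>

lemma geometric_second_moment:
  assumes "0 \<le> t"
  shows "integrable M (\<lambda>\<omega>. (geometric s x t \<omega>)\<^sup>2)"
    and "(\<integral>\<omega>. (geometric s x t \<omega>)\<^sup>2 \<partial>M) = x\<^sup>2 * exp (s\<^sup>2 * t)"
proof -
  note [measurable] = geometric_measurable[OF assms] increment_measurable[OF order_refl assms]
  define g where "g = (\<lambda>w. (x * exp (s * w - s\<^sup>2 / 2 * t))\<^sup>2)"
  have g[measurable]: "g \<in> borel_measurable borel" by (simp add: g_def)
  have AE: "AE \<omega> in M. (geometric s x t \<omega>)\<^sup>2 = g (B t \<omega> - B 0 \<omega>)"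
    using geometric_eq_increment[of s x t] by eventually_elim (simp add: g_def)
  have eq: "g (sqrt (t - 0) * z) = (x\<^sup>2 * exp (- (s\<^sup>2 * t))) * exp ((2 * s * sqrt t) * z)" for z
    by (simp add: g_def power_mult_distrib exp_double[symmetric] mult_exp_exp algebra_simps)
  have "integrable M (\<lambda>\<omega>. g (B t \<omega> - B 0 \<omega>))"
    unfolding increment_integral(2)[OF order_refl assms g] eq
    by (intro integrable_mult_right std_normal_exp)
  then show "integrable M (\<lambda>\<omega>. (geometric s x t \<omega>)\<^sup>2)"
    by (subst integrable_cong_AE[OF _ _ AE]) measurable
  have "(\<integral>\<omega>. (geometric s x t \<omega>)\<^sup>2 \<partial>M) = (\<integral>\<omega>. g (B t \<omega> - B 0 \<omega>) \<partial>M)"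
    by (intro integral_cong_AE AE) measurable
  also have "\<dots> = x\<^sup>2 * exp (s\<^sup>2 * t)"
    unfolding increment_integral(1)[OF order_refl assms g] eq
    using assms by (simp add: std_normal_exp mult_exp_exp power_mult_distrib)
  finally show "(\<integral>\<omega>. (geometric s x t \<omega>)\<^sup>2 \<partial>M) = x\<^sup>2 * exp (s\<^sup>2 * t)" .
qed

lemma ito_sum_measurable:
  assumes p: "vanishing_partitions t N p"
    and H: "\<And>u. 0 \<le> u \<Longrightarrow> u \<le> t \<Longrightarrow> H u \<in> borel_measurable (\<F> u)"
  shows "(\<lambda>\<omega>. \<Sum>i<N n. H (p n i) \<omega> * (B (p n (Suc i)) \<omega> - B (p n i) \<omega>)) \<in> borel_measurable M"
proof (intro borel_measurable_sum borel_measurable_times)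
  fix i assume "i \<in> {..<N n}"
  then have i: "i \<le> N n" "Suc i \<le> N n" by auto
  show "H (p n i) \<in> borel_measurable M"
    using vanishing_partitions_bounds[OF p i(1)] by (intro measurable_from_filtration[OF H])
  show "(\<lambda>\<omega>. B (p n (Suc i)) \<omega> - B (p n i) \<omega>) \<in> borel_measurable M"
    using vanishing_partitions_bounds[OF p i(1)] vanishing_partitions_mono[OF p _ i(2), of i]
    by (intro increment_measurable) auto
qed

text \<open>The error of the Riemann sums is the orthogonal sum of
  \<open>X u * (exp (s * w - s\<^sup>2 / 2 * d) - 1 - s * w)\<close> over the steps, where \<open>w\<close> is the increment of \<open>B\<close>
  over the step \<open>[u, u + d]\<close>; each summand has a second moment of order \<open>d\<^sup>2\<close>.\<close>

lemma geometric_has_ito_integral: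
  assumes t: "0 \<le> t"
  shows "has_ito_integral M \<F> B (\<lambda>u \<omega>. s * geometric s x u \<omega>) t
    (\<lambda>\<omega>. geometric s x t \<omega> - geometric s x 0 \<omega>)"
  unfolding has_ito_integral_def tendsto_in_probability_def
proof (intro conjI ballI allI impI)
  let ?X = "geometric s x"
  show "(\<lambda>\<omega>. s * ?X u \<omega>) \<in> borel_measurable (\<F> u)" if "u \<in> {0..t}" for u
    using geometric_adapted[of u s x] that by simp
  show "AE \<omega> in M. continuous_on {0..t} (\<lambda>u. s * ?X u \<omega>)"
    using geometric_continuous[of s x]
    by eventually_elim (intro continuous_intros, erule continuous_on_subset, simp)
  show I[measurable]: "(\<lambda>\<omega>. ?X t \<omega> - ?X 0 \<omega>) \<in> borel_measurable M"
    using geometric_measurable[of t] geometric_measurable[of 0] t by simp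
  fix N p assume p: "vanishing_partitions t N p"
  let ?S = "\<lambda>n \<omega>. \<Sum>i<N n. s * ?X (p n i) \<omega> * (B (p n (Suc i)) \<omega> - B (p n i) \<omega>)"
  show S[measurable]: "?S n \<in> borel_measurable M" for n
    using geometric_adapted[of _ s x] by (intro ito_sum_measurable[OF p]) simp
  fix e :: real assume e: "0 < e"
  define g where "g n i w = exp (s * w - s\<^sup>2 / 2 * (p n (Suc i) - p n i)) - 1 - s * w" for n i w
  have gm[measurable]: "g n i \<in> borel_measurable borel" for n i
    by (simp add: g_def[abs_def])
  \<comment> \<open>The process is multiplied by an exponential over each step. Subtracting 1 gives
    its relative increment, and removing the linear term \<open>s * w\<close> leaves
    \<open>g\<close>.\<close>
  have error: "?X t \<omega> - ?X 0 \<omega> - ?S n \<omega> =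
      (\<Sum>i<N n. ?X (p n i) \<omega> * g n i (B (p n (Suc i)) \<omega> - B (p n i) \<omega>))" for n \<omega>
  proof -
    have "?X (p n i) \<omega> * g n i (B (p n (Suc i)) \<omega> - B (p n i) \<omega>) =
      (?X (p n (Suc i)) \<omega> - ?X (p n i) \<omega>) - s * ?X (p n i) \<omega> * (B (p n (Suc i)) \<omega> - B (p n i) \<omega>)" for i
    proof -
      have "?X (p n (Suc i)) \<omega> = ?X (p n i) \<omega> *
          exp (s * (B (p n (Suc i)) \<omega> - B (p n i) \<omega>) - s\<^sup>2 / 2 * (p n (Suc i) - p n i))"
      proof -
        have "s * B (p n (Suc i)) \<omega> - s\<^sup>2 / 2 * p n (Suc i) = (s * B (p n i) \<omega> - s\<^sup>2 / 2 * p n i) +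
          (s * (B (p n (Suc i)) \<omega> - B (p n i) \<omega>) - s\<^sup>2 / 2 * (p n (Suc i) - p n i))"
          by (simp add: right_diff_distrib)
        then show ?thesis by (simp only: geometric_def exp_add mult.assoc)
      qed
      then show ?thesis by (simp add: g_def algebra_simps)
    qed
    then show ?thesis
      unfolding vanishing_partitions_sum[OF p, of "\<lambda>u. ?X u \<omega>" n, symmetric]
      by (simp only: sum_subtractf)
  qed
  have moment: "integrable M (\<lambda>\<omega>. (?X t \<omega> - ?X 0 \<omega> - ?S n \<omega>)\<^sup>2) \<and>
    (\<integral>\<omega>. (?X t \<omega> - ?X 0 \<omega> - ?S n \<omega>)\<^sup>2 \<partial>M) =
      (\<Sum>i<N n. x\<^sup>2 * exp (s\<^sup>2 * p n i) *
        (exp (s\<^sup>2 * (p n (Suc i) - p n i)) - 1 - s\<^sup>2 * (p n (Suc i) - p n i)))" for n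
  proof -
    have inc: "0 \<le> p n i \<and> p n i \<le> p n (Suc i)" if "i < N n" for i
      using that vanishing_partitions_bounds[OF p, of i n] vanishing_partitions_mono[OF p, of i "Suc i" n]
      by simp
    have g_moments: "(\<integral>\<omega>. g n i (B (p n (Suc i)) \<omega> - B (p n i) \<omega>) \<partial>M) = 0 \<and>
        integrable M (\<lambda>\<omega>. (g n i (B (p n (Suc i)) \<omega> - B (p n i) \<omega>))\<^sup>2) \<and>
        (\<integral>\<omega>. (g n i (B (p n (Suc i)) \<omega> - B (p n i) \<omega>))\<^sup>2 \<partial>M) =
          exp (s\<^sup>2 * (p n (Suc i) - p n i)) - 1 - s\<^sup>2 * (p n (Suc i) - p n i)" if "i < N n" for i
    proof -
      \<comment> \<open>A step of length \<open>d\<close> moves \<open>B\<close> by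
        \<open>sqrt d\<close> times a standard normal, so this \<open>c\<close> brings
        \<open>g\<close> into the form of the exponential remainder.\<close>
      define c where "c = s * sqrt (p n (Suc i) - p n i)"
      have c2: "c\<^sup>2 = s\<^sup>2 * (p n (Suc i) - p n i)"
        using inc[OF that] by (simp add: c_def power_mult_distrib)
      have gc: "g n i (sqrt (p n (Suc i) - p n i) * z) = exp (c * z - c\<^sup>2 / 2) - 1 - c * z" for z
        unfolding c2 by (simp add: g_def c_def mult.assoc)
      have g2: "(\<lambda>w. (g n i w)\<^sup>2) \<in> borel_measurable borel" by measurable
      show ?thesis
        using inc[OF that] increment_integral(1)[OF _ _ gm, of "p n i" "p n (Suc i)" n i]
          increment_integral(1,2)[OF _ _ g2, of "p n i" "p n (Suc i)"]
        by (simp add: gc std_normal_exp_remainder c2[symmetric])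
    qed
    note O = orthogonal_sum_second_moment[of "p n" "N n" "\<lambda>i. ?X (p n i)" "g n"]
    show ?thesis
      unfolding error using inc g_moments vanishing_partitions_bounds[OF p, of 0 n]
      by (subst O(2))
        (auto intro!: O(1) sum.cong geometric_adapted geometric_second_moment(1)
          simp: geometric_second_moment(2))
  qed
  show "(\<lambda>n. measure M {\<omega> \<in> space M. e < \<bar>?S n \<omega> - (?X t \<omega> - ?X 0 \<omega>)\<bar>}) \<longlonglongrightarrow> 0"
  proof (rule LIMSEQ_I)
    fix r :: real assume r: "0 < r"
    \<comment> \<open>The factor \<open>x\<^sup>2 * exp (s\<^sup>2 * t)\<close> bounds the second
      moments of the process on \<open>[0, t]\<close>, \<open>s\<^sup>2 * t\<close> is the sum of
      the step sizes times \<open>s\<^sup>2\<close>, and the division by \<open>e\<^sup>2\<close> is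
      Chebyshev's.\<close>
    define C where "C = x\<^sup>2 * exp (s\<^sup>2 * t) * (s\<^sup>2 * t) / e\<^sup>2"
    have C: "0 \<le> C" using t by (simp add: C_def)
    have "((\<lambda>d. C * (exp (s\<^sup>2 * d) - 1)) \<longlongrightarrow> C * (exp (s\<^sup>2 * 0) - 1)) (at_right 0)"
      by (intro tendsto_intros)
    then have "eventually (\<lambda>d. C * (exp (s\<^sup>2 * d) - 1) < r) (at_right 0)"
      using r by (intro order_tendstoD) auto
    then obtain d where d: "0 < d" "C * (exp (s\<^sup>2 * d) - 1) < r"
      by (metis (no_types, lifting) eventually_at_right_field dense)
    have "\<forall>\<^sub>F n in sequentially. \<forall>i<N n. p n (Suc i) - p n i < d"
      using p d(1) by (simp add: vanishing_partitions_def)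
    then obtain n0 where n0: "\<And>n i. n \<ge> n0 \<Longrightarrow> i < N n \<Longrightarrow> p n (Suc i) - p n i < d"
      by (auto simp: eventually_sequentially)
    have "norm (measure M {\<omega> \<in> space M. e < \<bar>?S n \<omega> - (?X t \<omega> - ?X 0 \<omega>)\<bar>} - 0) < r" if n: "n \<ge> n0" for n
    proof -
      have "measure M {\<omega> \<in> space M. e < \<bar>?S n \<omega> - (?X t \<omega> - ?X 0 \<omega>)\<bar>} \<le>
          measure M {\<omega> \<in> space M. e \<le> \<bar>?X t \<omega> - ?X 0 \<omega> - ?S n \<omega>\<bar>}"
        by (intro finite_measure_mono) auto
      also have "\<dots> \<le> (\<integral>\<omega>. (?X t \<omega> - ?X 0 \<omega> - ?S n \<omega>)\<^sup>2 \<partial>M) / e\<^sup>2"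
        using moment e by (intro second_moment_method) auto
      also have "(\<integral>\<omega>. (?X t \<omega> - ?X 0 \<omega> - ?S n \<omega>)\<^sup>2 \<partial>M) \<le>
          (\<Sum>i<N n. x\<^sup>2 * exp (s\<^sup>2 * t) * (s\<^sup>2 * (p n (Suc i) - p n i) * (exp (s\<^sup>2 * d) - 1)))"
        unfolding conjunct2[OF moment]
      proof (intro sum_mono mult_mono)
        fix i assume "i \<in> {..<N n}"
        then have i: "i < N n" by simp
        have le: "p n i \<le> p n (Suc i)" using vanishing_partitions_mono[OF p, of i "Suc i" n] i by simp
        define y where "y = s\<^sup>2 * (p n (Suc i) - p n i)"
        have y: "0 \<le> y" "y \<le> s\<^sup>2 * d"
          using le n0[OF n i] unfolding y_def by (auto intro!: mult_left_mono)
        have "exp y - 1 - y \<le> y * (exp y - 1)" by (rule exp_remainder_le)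
        also have "\<dots> \<le> y * (exp (s\<^sup>2 * d) - 1)" using y by (intro mult_left_mono) auto
        finally show "exp (s\<^sup>2 * (p n (Suc i) - p n i)) - 1 - s\<^sup>2 * (p n (Suc i) - p n i) \<le>
          s\<^sup>2 * (p n (Suc i) - p n i) * (exp (s\<^sup>2 * d) - 1)" by (simp add: y_def)
        show "exp (s\<^sup>2 * p n i) \<le> exp (s\<^sup>2 * t)"
          using vanishing_partitions_bounds[OF p, of i n] i by (simp add: mult_left_mono)
        show "0 \<le> exp (s\<^sup>2 * (p n (Suc i) - p n i)) - 1 - s\<^sup>2 * (p n (Suc i) - p n i)"
          using exp_ge_add_one_self[of y] unfolding y_def by linarith
      qed auto
      also have "\<dots> = x\<^sup>2 * exp (s\<^sup>2 * t) * (s\<^sup>2 * (t - 0) * (exp (s\<^sup>2 * d) - 1))"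
        unfolding vanishing_partitions_sum[OF p, of "\<lambda>u. u" n, symmetric]
        by (simp only: sum_distrib_left sum_distrib_right)
      also have "\<dots> / e\<^sup>2 = C * (exp (s\<^sup>2 * d) - 1)" by (simp add: C_def)
      finally show ?thesis using d(2) e by (simp add: divide_right_mono)
    qed
    then show "\<exists>no. \<forall>n\<ge>no. norm (measure M {\<omega> \<in> space M. e < \<bar>?S n \<omega> - (?X t \<omega> - ?X 0 \<omega>)\<bar>} - 0) < r"
      by blast
  qed
qed

text \<open>The drift is kept in the shape \<open>0 * k\<close>, which is what the capital equation
  becomes when the growth rate is replaced by 0.\<close>

lemma geometric_sde_solution: "sde_solution M \<F> B (\<lambda>k. 0 * k) (\<lambda>k. s * k) x (geometric s x)"
  unfolding sde_solution_def
  using geometric_adapted geometric_continuous geometric_0 geometric_has_ito_integral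
  by (auto intro!: exI[where x = "\<lambda>\<omega>. geometric s x t \<omega> - geometric s x 0 \<omega>" for t])

end

section \<open>Uniqueness for the linear equation\<close>

text \<open>A violation at \<open>t\<close> would persist on an interval to the left of
  \<open>t\<close>, which contains a rational; \<open>t = 0\<close> leaves no room on the left but
  is itself rational. Bounds at countably many times thus control the terminal value.\<close>

lemma continuous_bound_from_rationals:
  fixes f :: "real \<Rightarrow> real"
  assumes f: "continuous_on {0..t} f" and t: "0 \<le> t"
    and bound: "\<And>q. q \<in> \<rat> \<Longrightarrow> 0 \<le> q \<Longrightarrow> q \<le> t \<Longrightarrow> \<bar>f q\<bar> \<le> R"
  shows "\<bar>f t\<bar> \<le> R"
proof (rule ccontr)
  assume "\<not> \<bar>f t\<bar> \<le> R"
  then have gap: "0 < \<bar>f t\<bar> - R" by simp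
  with f t obtain d where d: "d > 0" "\<And>u. 0 \<le> u \<Longrightarrow> u \<le> t \<Longrightarrow> \<bar>u - t\<bar> < d \<Longrightarrow> \<bar>f u - f t\<bar> < \<bar>f t\<bar> - R"
    unfolding continuous_on_iff dist_real_def by (metis atLeastAtMost_iff order_refl)
  show False
  proof (cases "t = 0")
    case True
    then show False using bound[of 0] gap by simp
  next
    case False
    then have "max 0 (t - d) < t" using t d by simp
    then obtain q where "q \<in> \<rat>" "max 0 (t - d) < q" "q < t" using Rats_dense_in_real by blast
    then show False using bound[of q] d(2)[of q] by simp
  qed
qed

text \<open>The Ito integral is specified by what happens along every vanishing sequence of
  partitions; this is the concrete sequence to which the specification is applied. Taking
  \<open>Suc n\<close> steps keeps the denominator positive.\<close>

lemma uniform_partitions_vanishing: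
  assumes "0 \<le> t"
  shows "vanishing_partitions t Suc (\<lambda>n i. t * real i / real (Suc n))"
  unfolding vanishing_partitions_def
proof (intro conjI allI impI)
  fix e :: real assume e: "0 < e"
  have "(\<lambda>n. t * inverse (real (Suc n))) \<longlonglongrightarrow> t * 0"
    by (intro tendsto_intros LIMSEQ_inverse_real_of_nat)
  then have "\<forall>\<^sub>F n in sequentially. t * inverse (real (Suc n)) < e"
    using e by (intro order_tendstoD) simp_all
  then show "\<forall>\<^sub>F n in sequentially. \<forall>i<Suc n. t * real (Suc i) / real (Suc n) - t * real i / real (Suc n) < e"
    by eventually_elim (simp add: divide_inverse algebra_simps)
next
  fix n i
  show "t * real i / real (Suc n) \<le> t * real (Suc i) / real (Suc n)"
    using assms by (intro divide_right_mono mult_left_mono) auto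
qed auto

lemma tendsto_in_probability_cong_AE:
  assumes "tendsto_in_probability M S I" and J: "J \<in> borel_measurable M"
    and eq: "AE \<omega> in M. I \<omega> = J \<omega>"
  shows "tendsto_in_probability M S J"
proof -
  have [measurable]: "S n \<in> borel_measurable M" "I \<in> borel_measurable M" for n
    using assms(1) by (auto simp: tendsto_in_probability_def)
  note [measurable] = J
  have "measure M {\<omega> \<in> space M. \<bar>S n \<omega> - I \<omega>\<bar> > e} = measure M {\<omega> \<in> space M. \<bar>S n \<omega> - J \<omega>\<bar> > e}" for n e
    using eq by (intro measure_eq_AE) auto
  then show ?thesis
    using assms by (simp add: tendsto_in_probability_def)
qed

context prob_space
begin

lemma tendsto_in_probability_diff:
  assumes "tendsto_in_probability M S I" "tendsto_in_probability M T J"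
  shows "tendsto_in_probability M (\<lambda>n \<omega>. S n \<omega> - T n \<omega>) (\<lambda>\<omega>. I \<omega> - J \<omega>)"
  unfolding tendsto_in_probability_def
proof (intro conjI allI impI)
  have [measurable]: "S n \<in> borel_measurable M" "I \<in> borel_measurable M"
    "T n \<in> borel_measurable M" "J \<in> borel_measurable M" for n
    using assms by (auto simp: tendsto_in_probability_def)
  show "(\<lambda>\<omega>. S n \<omega> - T n \<omega>) \<in> borel_measurable M" "(\<lambda>\<omega>. I \<omega> - J \<omega>) \<in> borel_measurable M" for n
    by measurable
  fix e :: real assume e: "0 < e"
  let ?A = "\<lambda>n. {\<omega> \<in> space M. \<bar>S n \<omega> - I \<omega>\<bar> > e / 2}"
  let ?B = "\<lambda>n. {\<omega> \<in> space M. \<bar>T n \<omega> - J \<omega>\<bar> > e / 2}"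
  have lim: "(\<lambda>n. measure M (?A n) + measure M (?B n)) \<longlonglongrightarrow> 0 + 0"
    using assms half_gt_zero[OF e] unfolding tendsto_in_probability_def by (intro tendsto_add) blast+
  have le: "measure M {\<omega> \<in> space M. \<bar>S n \<omega> - T n \<omega> - (I \<omega> - J \<omega>)\<bar> > e} \<le>
      measure M (?A n) + measure M (?B n)" for n
  proof -
    have "measure M {\<omega> \<in> space M. \<bar>S n \<omega> - T n \<omega> - (I \<omega> - J \<omega>)\<bar> > e} \<le> measure M (?A n \<union> ?B n)"
    proof (intro finite_measure_mono subsetI)
      fix \<omega> assume \<omega>: "\<omega> \<in> {\<omega> \<in> space M. \<bar>S n \<omega> - T n \<omega> - (I \<omega> - J \<omega>)\<bar> > e}"
      then have "e / 2 < \<bar>S n \<omega> - I \<omega>\<bar> \<or> e / 2 < \<bar>T n \<omega> - J \<omega>\<bar>"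
        by (simp add: abs_if split: if_splits) linarith+
      with \<omega> show "\<omega> \<in> ?A n \<union> ?B n" by blast
    qed simp
    also have "\<dots> \<le> measure M (?A n) + measure M (?B n)"
      by (intro measure_subadditive) (auto simp: emeasure_eq_measure)
    finally show ?thesis .
  qed
  show "(\<lambda>n. measure M {\<omega> \<in> space M. \<bar>S n \<omega> - T n \<omega> - (I \<omega> - J \<omega>)\<bar> > e}) \<longlonglongrightarrow> 0"
    by (rule tendsto_sandwich[OF _ _ tendsto_const lim[unfolded add_0]])
      (intro always_eventually allI le measure_nonneg)+
qed

end

context brownian_motion
begin

lemma increment_moments:
  assumes "0 \<le> u" "u \<le> t"
  shows "(\<integral>\<omega>. B t \<omega> - B u \<omega> \<partial>M) = 0" "integrable M (\<lambda>\<omega>. (B t \<omega> - B u \<omega>)\<^sup>2)"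
    "(\<integral>\<omega>. (B t \<omega> - B u \<omega>)\<^sup>2 \<partial>M) = t - u"
  using assms increment_integral(1)[OF assms, of "\<lambda>w. w"] increment_integral(1,2)[OF assms, of "\<lambda>w. w\<^sup>2"]
  by (simp_all add: std_normal_power power_mult_distrib)

text \<open>Uniqueness for \<open>dZ = s Z dB\<close> with \<open>Z 0 = 0\<close>. No moments of \<open>Z\<close> are known, so \<open>Z\<close> is cut off at
  the events \<open>G t\<close>, which are adapted because only rational times enter. With
  \<open>\<psi> t = E[1 (G t) * (Z t)\<^sup>2]\<close>, orthogonality of the cut-off Riemann sums gives
  \<open>\<psi> t \<le> s\<^sup>2 * \<integral>\<^sub>0\<^sup>t \<psi>\<close> up to errors that vanish with the mesh, and hence a bound
  \<open>\<psi> t \<le> C * exp (2 * s\<^sup>2 * t)\<close> improves to half of itself.\<close>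

lemma linear_sde_zero:
  fixes Z :: "real \<Rightarrow> 'a \<Rightarrow> real"
  assumes s: "s \<noteq> 0"
    and adapted: "\<And>u. 0 \<le> u \<Longrightarrow> Z u \<in> borel_measurable (\<F> u)"
    and cont: "AE \<omega> in M. continuous_on {0..} (\<lambda>u. Z u \<omega>)"
    and ito: "\<And>u N p. 0 \<le> u \<Longrightarrow> vanishing_partitions u N p \<Longrightarrow> tendsto_in_probability M
       (\<lambda>n \<omega>. \<Sum>i<N n. s * Z (p n i) \<omega> * (B (p n (Suc i)) \<omega> - B (p n i) \<omega>)) (Z u)"
    and t: "0 \<le> t"
  shows "AE \<omega> in M. Z t \<omega> = 0"
proof -
  have meas: "Z u \<in> borel_measurable M" if "0 \<le> u" for u
    by (rule measurable_from_filtration[OF adapted[OF that]])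
  define G where "G R u = {\<omega> \<in> space M. \<forall>q \<in> \<rat> \<inter> {0..u}. \<bar>Z q \<omega>\<bar> \<le> R}" for R u
  have G_sets: "G R u \<in> sets (\<F> u)" for R u
  proof -
    have "{\<omega> \<in> space (\<F> u). \<forall>q \<in> \<rat> \<inter> {0..u}. \<bar>Z q \<omega>\<bar> \<le> R} \<in> sets (\<F> u)"
    proof (rule sets.sets_Collect_countable_All')
      fix q assume "q \<in> \<rat> \<inter> {0..u}"
      then have [measurable]: "Z q \<in> borel_measurable (\<F> u)"
        using adapted by (auto intro: measurable_filtration_mono)
      show "{\<omega> \<in> space (\<F> u). \<bar>Z q \<omega>\<bar> \<le> R} \<in> sets (\<F> u)" by measurable
    next
      show "countable (\<rat> \<inter> {0..u})" using countable_rat by blast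
    qed
    then show ?thesis unfolding G_def space_F by simp
  qed
  have G_M[measurable]: "G R u \<in> sets M" for R u
    using G_sets[of R u] subalgebra_filtration[of u] by (auto simp: subalgebra_def)
  \<comment> \<open>The events shrink with time: on \<open>G R u\<close> all earlier indicators
    equal 1, so cutting off does not change the Riemann sum there.\<close>
  have G_mono: "G R v \<subseteq> G R u" if "u \<le> v" for R u v
    using that by (auto simp: G_def)
  have G_bound: "AE \<omega> in M. \<omega> \<in> G R u \<longrightarrow> \<bar>Z u \<omega>\<bar> \<le> R" if "0 \<le> u" for R u
    using cont
  proof eventually_elim
    case (elim \<omega>)
    then have "continuous_on {0..u} (\<lambda>u. Z u \<omega>)" by (rule continuous_on_subset) auto
    then show ?case
      using continuous_bound_from_rationals[of u "\<lambda>u. Z u \<omega>" R] that by (auto simp: G_def)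
  qed
  have zero_on_G: "AE \<omega> in M. \<omega> \<in> G R t \<longrightarrow> Z t \<omega> = 0" if R: "0 \<le> R" for R
  proof -
    define \<psi> where "\<psi> u = (\<integral>\<omega>. (indicator (G R u) \<omega> * Z u \<omega>)\<^sup>2 \<partial>M)" for u
    have cut_bound: "AE \<omega> in M. (indicator (G R u) \<omega> * Z u \<omega>)\<^sup>2 \<le> R\<^sup>2" if "0 \<le> u" for u
      using G_bound[OF that, of R]
    proof eventually_elim
      case (elim \<omega>)
      then have "\<bar>indicator (G R u) \<omega> * Z u \<omega>\<bar> \<le> R" using R by (auto simp: indicator_def)
      then show ?case by (metis abs_ge_zero power2_abs power_mono)
    qed
    have cut_int: "integrable M (\<lambda>\<omega>. (indicator (G R u) \<omega> * Z u \<omega>)\<^sup>2)" if "0 \<le> u" for u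
      using meas[OF that] cut_bound[OF that] by (intro integrable_const_bound[where B = "R\<^sup>2"]) auto
    have \<psi>_bound: "\<psi> u \<le> R\<^sup>2" if "0 \<le> u" for u
      using integral_mono_AE[OF cut_int[OF that] _ cut_bound[OF that]] by (simp add: \<psi>_def prob_space)
    \<comment> \<open>This rate gives the gain of the iteration: \<open>s\<^sup>2\<close> times the
      integral of \<open>C * exp (a * v)\<close> over \<open>[0, u]\<close> is at most half of
      \<open>C * exp (a * u)\<close>.\<close>
    define a where "a = 2 * s\<^sup>2"
    have a: "0 < a" using s by (simp add: a_def)
    have step: "\<psi> u \<le> C / 2 * exp (a * u)"
      if C: "0 \<le> C" "\<And>v. 0 \<le> v \<Longrightarrow> \<psi> v \<le> C * exp (a * v)" and u: "0 \<le> u" for C u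
    proof (rule field_le_epsilon)
      fix \<epsilon> :: real assume \<epsilon>: "0 < \<epsilon>"
      \<comment> \<open>The denominator makes \<open>2 * e * R \<le> \<epsilon>\<close> and is
        positive even for \<open>R = 0\<close>.\<close>
      define e where "e = \<epsilon> / (2 * R + 1)"
      have e: "0 < e" "2 * e * R \<le> \<epsilon>" using \<epsilon> R by (auto simp: e_def field_simps)
      define p where "p n i = u * real i / real (Suc n)" for n i
      have p: "vanishing_partitions u Suc p"
        unfolding p_def[abs_def] by (rule uniform_partitions_vanishing[OF u])
      define S where "S n \<omega> = (\<Sum>i<Suc n. s * Z (p n i) \<omega> * (B (p n (Suc i)) \<omega> - B (p n i) \<omega>))" for n \<omega>
      \<comment> \<open>Each summand is cut off at its own left endpoint, not at the final time, so
        that the integrand remains adapted and becomes square integrable.\<close>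
      define V where "V n \<omega> = (\<Sum>i<Suc n. (s * (indicator (G R (p n i)) \<omega> * Z (p n i) \<omega>)) *
        (B (p n (Suc i)) \<omega> - B (p n i) \<omega>))" for n \<omega>
      define bad where "bad n = {\<omega> \<in> space M. \<bar>S n \<omega> - Z u \<omega>\<bar> > e}" for n
      have "tendsto_in_probability M S (Z u)"
        using ito[OF u p] by (simp add: S_def[abs_def])
      then have bad0: "(\<lambda>n. measure M (bad n)) \<longlonglongrightarrow> 0" and [measurable]: "S n \<in> borel_measurable M" for n
        using e by (auto simp: bad_def tendsto_in_probability_def)
      have [measurable]: "Z u \<in> borel_measurable M" by (rule meas[OF u])
      have bad_sets[measurable]: "bad n \<in> sets M" for n unfolding bad_def by measurable
      have inc: "0 \<le> p n i \<and> p n i \<le> p n (Suc i) \<and> p n i \<le> u" if "i < Suc n" for n i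
        using that vanishing_partitions_bounds[OF p, of i n] vanishing_partitions_mono[OF p, of i "Suc i" n]
        by simp
      have V2: "integrable M (\<lambda>\<omega>. (V n \<omega>)\<^sup>2)"
        "(\<integral>\<omega>. (V n \<omega>)\<^sup>2 \<partial>M) = (\<Sum>i<Suc n. s\<^sup>2 * \<psi> (p n i) * (p n (Suc i) - p n i))" for n
      proof -
        define H where "H i = (\<lambda>\<omega>. s * (indicator (G R (p n i)) \<omega> * Z (p n i) \<omega>))" for i
        have H: "H i \<in> borel_measurable (\<F> (p n i))" if "i < Suc n" for i
          unfolding H_def
          by (intro borel_measurable_times borel_measurable_const borel_measurable_indicator G_sets
              adapted conjunct1[OF inc[OF that]])
        have H2: "integrable M (\<lambda>\<omega>. (H i \<omega>)\<^sup>2)" "(\<integral>\<omega>. (H i \<omega>)\<^sup>2 \<partial>M) = s\<^sup>2 * \<psi> (p n i)"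
          if "i < Suc n" for i
          using cut_int[of "p n i"] inc[OF that]
          by (simp_all add: H_def power_mult_distrib[of s] \<psi>_def)
        note O = orthogonal_sum_second_moment[of "p n" "Suc n" H "\<lambda>_ w. w"]
        have V: "V n = (\<lambda>\<omega>. \<Sum>i<Suc n. H i \<omega> * (B (p n (Suc i)) \<omega> - B (p n i) \<omega>))"
          by (simp add: V_def[abs_def] H_def)
        show "integrable M (\<lambda>\<omega>. (V n \<omega>)\<^sup>2)"
          unfolding V using inc H H2 increment_moments by (intro O(1)) auto
        show "(\<integral>\<omega>. (V n \<omega>)\<^sup>2 \<partial>M) = (\<Sum>i<Suc n. s\<^sup>2 * \<psi> (p n i) * (p n (Suc i) - p n i))"
          unfolding V using inc H H2 increment_moments
          by (subst O(2)) (auto intro!: sum.cong simp del: sum.lessThan_Suc)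
      qed
      \<comment> \<open>On \<open>G R u\<close> outside \<open>bad n\<close>, \<open>V n\<close>
        equals \<open>S n\<close> and lies within \<open>e\<close> of \<open>Z u\<close>; expanding
        \<open>(V n)\<^sup>2\<close> around \<open>Z u\<close> and dropping a square costs
        \<open>2 * e * R\<close>. On \<open>bad n\<close> only the bound \<open>R\<^sup>2\<close> is
        left, at a cost proportional to a vanishing probability.\<close>
      have pointwise: "AE \<omega> in M. (indicator (G R u) \<omega> * Z u \<omega>)\<^sup>2 \<le>
          (V n \<omega>)\<^sup>2 + (2 * e * R + R\<^sup>2 * indicator (bad n) \<omega>)" for n
        using G_bound[OF u, of R] cut_bound[OF u] AE_space
      proof eventually_elim
        case (elim \<omega>)
        have nonneg: "0 \<le> (V n \<omega>)\<^sup>2" "0 \<le> 2 * e * R" using e R by auto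
        show ?case
        proof (cases "\<omega> \<in> G R u \<and> \<omega> \<notin> bad n")
          case True
          have "indicator (G R (p n i)) \<omega> = (1 :: real)" if "i < Suc n" for i
            using True G_mono[of "p n i" u R] inc[OF that] by auto
          then have "V n \<omega> = S n \<omega>"
            unfolding V_def S_def by (intro sum.cong) auto
          then have close: "\<bar>V n \<omega> - Z u \<omega>\<bar> \<le> e" using True elim(3) by (auto simp: bad_def)
          have "\<bar>Z u \<omega> * (V n \<omega> - Z u \<omega>)\<bar> \<le> R * e"
            unfolding abs_mult using close elim(1) True R by (intro mult_mono) auto
          moreover have "(V n \<omega>)\<^sup>2 = (Z u \<omega>)\<^sup>2 + 2 * (Z u \<omega> * (V n \<omega> - Z u \<omega>)) + (V n \<omega> - Z u \<omega>)\<^sup>2"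
            by (simp add: power2_eq_square algebra_simps)
          moreover have "0 \<le> (V n \<omega> - Z u \<omega>)\<^sup>2" by simp
          ultimately have "(Z u \<omega>)\<^sup>2 \<le> (V n \<omega>)\<^sup>2 + 2 * e * R"
            by (simp only: abs_le_iff mult.commute[of R e] mult.assoc) linarith
          then show ?thesis using True by simp
        next
          case False
          show ?thesis
          proof (cases "\<omega> \<in> G R u")
            case True
            with False have "indicator (bad n) \<omega> = (1 :: real)" by simp
            then have "(V n \<omega>)\<^sup>2 + (2 * e * R + R\<^sup>2 * indicator (bad n) \<omega>) = R\<^sup>2 + ((V n \<omega>)\<^sup>2 + 2 * e * R)"
              by simp
            then show ?thesis using elim(2) nonneg by linarith
          next
            case False
            then show ?thesis using nonneg by simp
          qed
        qed
      qed
      have bound: "\<psi> u \<le> (C / 2 * exp (a * u) + 2 * e * R) + R\<^sup>2 * measure M (bad n)" for n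
      proof -
        have "\<psi> u \<le> (\<integral>\<omega>. (V n \<omega>)\<^sup>2 + (2 * e * R + R\<^sup>2 * indicator (bad n) \<omega>) \<partial>M)"
          unfolding \<psi>_def using V2(1) cut_int[OF u] pointwise
          by (intro integral_mono_AE) (auto simp: less_top[symmetric])
        also have "\<dots> = (\<integral>\<omega>. (V n \<omega>)\<^sup>2 \<partial>M) + (2 * e * R + R\<^sup>2 * measure M (bad n))"
          using V2(1) by (subst Bochner_Integration.integral_add) (auto simp: less_top[symmetric] prob_space)
        also have "(\<integral>\<omega>. (V n \<omega>)\<^sup>2 \<partial>M) \<le>
            (\<Sum>i<Suc n. C / 2 * (exp (a * p n (Suc i)) - exp (a * p n i)))"
          unfolding V2(2)
        proof (rule sum_mono)
          fix i assume "i \<in> {..<Suc n}"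
          then have i: "i < Suc n" by simp
          define d where "d = p n (Suc i) - p n i"
          have "s\<^sup>2 * \<psi> (p n i) * d \<le> s\<^sup>2 * (C * exp (a * p n i)) * d"
            using C inc[OF i] by (intro mult_right_mono mult_left_mono) (auto simp: d_def)
          also have "\<dots> = C / 2 * (exp (a * p n i) * (a * d))" by (simp add: a_def)
          \<comment> \<open>By \<open>1 + y \<le> exp y\<close> the left-endpoint sum of the
            increasing exponential is dominated by a telescoping sum.\<close>
          also have "\<dots> \<le> C / 2 * (exp (a * p n i) * (exp (a * d) - 1))"
            using exp_ge_add_one_self[of "a * d"] C by (intro mult_left_mono) (linarith | simp)+
          also have "\<dots> = C / 2 * (exp (a * p n (Suc i)) - exp (a * p n i))"
            by (simp add: d_def right_diff_distrib mult_exp_exp)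
          finally show "s\<^sup>2 * \<psi> (p n i) * (p n (Suc i) - p n i) \<le>
            C / 2 * (exp (a * p n (Suc i)) - exp (a * p n i))" by (simp add: d_def)
        qed
        also have "\<dots> = C / 2 * (exp (a * u) - exp (a * 0))"
          unfolding sum_distrib_left[symmetric] vanishing_partitions_sum[OF p, of "\<lambda>v. exp (a * v)"] ..
        also have "\<dots> \<le> C / 2 * exp (a * u)" using C by (intro mult_left_mono) auto
        finally show ?thesis by simp
      qed
      have "(\<lambda>n. (C / 2 * exp (a * u) + 2 * e * R) + R\<^sup>2 * measure M (bad n)) \<longlonglongrightarrow>
          (C / 2 * exp (a * u) + 2 * e * R) + R\<^sup>2 * 0"
        by (intro tendsto_intros bad0)
      then have "\<psi> u \<le> (C / 2 * exp (a * u) + 2 * e * R) + R\<^sup>2 * 0"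
        by (rule LIMSEQ_le_const) (use bound in blast)
      then show "\<psi> u \<le> C / 2 * exp (a * u) + \<epsilon>" using e by simp
    qed
    have iterate: "\<psi> u \<le> R\<^sup>2 * (1 / 2) ^ k * exp (a * u)" if "0 \<le> u" for k u
      using that
    proof (induction k arbitrary: u)
      case 0
      have "R\<^sup>2 * 1 \<le> R\<^sup>2 * exp (a * u)" using 0 a by (intro mult_left_mono) auto
      then show ?case using \<psi>_bound[OF 0] by simp
    next
      case (Suc k)
      show ?case using step[OF _ Suc.IH Suc.prems] by simp
    qed
    have "(\<lambda>k. R\<^sup>2 * (1 / 2) ^ k * exp (a * t)) \<longlonglongrightarrow> R\<^sup>2 * 0 * exp (a * t)"
      by (intro tendsto_intros LIMSEQ_power_zero) simp
    then have "\<psi> t \<le> R\<^sup>2 * 0 * exp (a * t)"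
      by (rule LIMSEQ_le_const) (use iterate[OF t] in blast)
    then have "\<psi> t = 0"
      unfolding \<psi>_def by (intro antisym integral_nonneg_AE) auto
    then have "AE \<omega> in M. (indicator (G R t) \<omega> * Z t \<omega>)\<^sup>2 = 0"
      unfolding \<psi>_def by (subst (asm) integral_nonneg_eq_0_iff_AE[OF cut_int[OF t]]) auto
    then show ?thesis
      by eventually_elim (auto simp: indicator_def)
  qed
  \<comment> \<open>Integer cut-offs suffice: a continuous path is bounded on \<open>[0, t]\<close>,
    so it belongs to some \<open>G (real m) t\<close>, and only countably many null sets are
    discarded.\<close>
  have "AE \<omega> in M. \<forall>m :: nat. \<omega> \<in> G (real m) t \<longrightarrow> Z t \<omega> = 0"
    unfolding AE_all_countable using zero_on_G by simp
  with cont AE_space show ?thesis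
  proof eventually_elim
    case (elim \<omega>)
    then have "compact ((\<lambda>u. Z u \<omega>) ` {0..t})"
      by (intro compact_continuous_image) (auto intro: continuous_on_subset)
    then obtain b where b: "\<And>u. 0 \<le> u \<Longrightarrow> u \<le> t \<Longrightarrow> \<bar>Z u \<omega>\<bar> \<le> b"
      using compact_imp_bounded bounded_iff by (metis (no_types, lifting) atLeastAtMost_iff image_eqI real_norm_def)
    obtain m :: nat where "b \<le> real m" using real_arch_simple by blast
    with b elim(2) have "\<omega> \<in> G (real m) t" by (force simp: G_def)
    with elim(3) show ?case by blast
  qed
qed

text \<open>The drift integral is zero, so the Ito integral supplied by the solution is almost
  surely \<open>X t - x\<close>, and a limit in probability may be changed on a null set.\<close>

lemma linear_sde_riemann_sums:
  assumes X: "sde_solution M \<F> B (\<lambda>k. 0 * k) (\<lambda>k. s * k) x X" and t: "0 \<le> t"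
    and p: "vanishing_partitions t N p"
  shows "tendsto_in_probability M
    (\<lambda>n \<omega>. \<Sum>i<N n. s * X (p n i) \<omega> * (B (p n (Suc i)) \<omega> - B (p n i) \<omega>)) (\<lambda>\<omega>. X t \<omega> - x)"
proof -
  from X t obtain I where I: "has_ito_integral M \<F> B (\<lambda>u \<omega>. s * X u \<omega>) t I"
    "AE \<omega> in M. X t \<omega> = X 0 \<omega> + integral {0..t} (\<lambda>u. 0 * X u \<omega>) + I \<omega>"
    and X0: "AE \<omega> in M. X 0 \<omega> = x" and Xt: "X t \<in> borel_measurable (\<F> t)"
    unfolding sde_solution_def by blast
  show ?thesis
  proof (rule tendsto_in_probability_cong_AE)
    show "tendsto_in_probability M
      (\<lambda>n \<omega>. \<Sum>i<N n. s * X (p n i) \<omega> * (B (p n (Suc i)) \<omega> - B (p n i) \<omega>)) I"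
      using I(1) p by (simp add: has_ito_integral_def)
    show "(\<lambda>\<omega>. X t \<omega> - x) \<in> borel_measurable M"
      using measurable_from_filtration[OF Xt] by simp
    show "AE \<omega> in M. I \<omega> = X t \<omega> - x"
      using I(2) X0 by eventually_elim simp
  qed
qed

text \<open>By linearity the difference of two solutions solves the same equation from 0. Equality
  at each fixed date is enough, because the cross-section involves only the laws at single
  dates.\<close>

lemma linear_sde_unique:
  assumes s: "s \<noteq> 0" and t: "0 \<le> t"
    and X: "sde_solution M \<F> B (\<lambda>k. 0 * k) (\<lambda>k. s * k) x X"
    and Y: "sde_solution M \<F> B (\<lambda>k. 0 * k) (\<lambda>k. s * k) x Y"
  shows "AE \<omega> in M. X t \<omega> = Y t \<omega>"
proof -
  have "AE \<omega> in M. X t \<omega> - Y t \<omega> = 0"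
  proof (rule linear_sde_zero[OF s _ _ _ t])
    show "(\<lambda>\<omega>. X u \<omega> - Y u \<omega>) \<in> borel_measurable (\<F> u)" if "0 \<le> u" for u
      using X Y that unfolding sde_solution_def by (intro borel_measurable_diff) blast+
    have "AE \<omega> in M. continuous_on {0..} (\<lambda>u. X u \<omega>)" "AE \<omega> in M. continuous_on {0..} (\<lambda>u. Y u \<omega>)"
      using X Y by (simp_all add: sde_solution_def)
    then show "AE \<omega> in M. continuous_on {0..} (\<lambda>u. X u \<omega> - Y u \<omega>)"
      by eventually_elim (rule continuous_on_diff)
    fix u N p assume u: "0 \<le> u" and p: "vanishing_partitions u N p"
    show "tendsto_in_probability M
       (\<lambda>n \<omega>. \<Sum>i<N n. s * (X (p n i) \<omega> - Y (p n i) \<omega>) * (B (p n (Suc i)) \<omega> - B (p n i) \<omega>))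
       (\<lambda>\<omega>. X u \<omega> - Y u \<omega>)"
      using tendsto_in_probability_diff[OF linear_sde_riemann_sums[OF X u p] linear_sde_riemann_sums[OF Y u p]]
      by (simp add: sum_subtractf[symmetric] algebra_simps)
  qed
  then show ?thesis by simp
qed

end

section \<open>The lognormal semigroup\<close>

text \<open>Built from one standard normal instead of from \<open>geometric\<close>: the law then
  makes sense without \<open>M\<close> and \<open>B\<close>, and its measurability in
  \<open>x\<close> and in \<open>t\<close> is visible from the formula.\<close>

definition lognormal_law :: "real \<Rightarrow> real \<Rightarrow> real \<Rightarrow> real measure" where
  "lognormal_law s x t = distr std_normal borel (\<lambda>z. x * exp (s * (sqrt t * z) - s\<^sup>2 / 2 * t))"

lemma sets_lognormal_law[simp, measurable_cong]: "sets (lognormal_law s x t) = sets borel"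
  by (simp add: lognormal_law_def)

lemma prob_space_lognormal_law: "prob_space (lognormal_law s x t)"
  unfolding lognormal_law_def by (rule prob_space.prob_space_distr[OF prob_space_std_normal]) simp

lemma emeasure_lognormal_law:
  assumes "A \<in> sets borel"
  shows "emeasure (lognormal_law s x t) A =
    (\<integral>\<^sup>+z. indicator A (x * exp (s * (sqrt t * z) - s\<^sup>2 / 2 * t)) \<partial>std_normal)"
  using assms unfolding lognormal_law_def by (simp add: emeasure_distr_nn_integral)

context brownian_motion
begin

lemma lognormal_law_increment:
  assumes "0 \<le> r" "0 \<le> t"
  shows "lognormal_law s x t = distr M borel (\<lambda>\<omega>. x * exp (s * (B (r + t) \<omega> - B r \<omega>) - s\<^sup>2 / 2 * t))"
proof -
  have [measurable]: "(\<lambda>\<omega>. B (r + t) \<omega> - B r \<omega>) \<in> borel_measurable M"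
    using assms by (intro increment_measurable) auto
  have "lognormal_law s x t =
      distr (distr std_normal borel (\<lambda>z. sqrt ((r + t) - r) * z)) borel (\<lambda>w. x * exp (s * w - s\<^sup>2 / 2 * t))"
    unfolding lognormal_law_def by (subst distr_distr) (simp_all add: comp_def)
  also have "\<dots> = distr M borel (\<lambda>\<omega>. x * exp (s * (B (r + t) \<omega> - B r \<omega>) - s\<^sup>2 / 2 * t))"
    using assms by (subst increment_distr[symmetric]) (simp_all add: distr_distr comp_def)
  finally show ?thesis .
qed

text \<open>Brownian motion supplies two independent normals, its increments over
  \<open>[0, u]\<close> and \<open>[u, u + t]\<close>. Their exponents add up, and Fubini integrates
  out the second one first. For \<open>t = 0\<close> the inner law is the point mass at
  \<open>y\<close>.\<close>

lemma lognormal_law_semigroup: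
  assumes u: "0 \<le> u" and t: "0 \<le> t" and A[measurable]: "A \<in> sets borel"
  shows "(\<integral>\<^sup>+y. emeasure (lognormal_law s y t) A \<partial>lognormal_law s x u) = emeasure (lognormal_law s x (u + t)) A"
proof (cases "t = 0")
  case True
  interpret N: prob_space std_normal by (rule prob_space_std_normal)
  have "emeasure (lognormal_law s y 0) A = indicator A y" for y
    using N.emeasure_space_1 by (simp add: emeasure_lognormal_law)
  then show ?thesis using True by (simp add: nn_integral_indicator)
next
  case False
  define W1 where "W1 = (\<lambda>\<omega>. B u \<omega> - B 0 \<omega>)"
  define W2 where "W2 = (\<lambda>\<omega>. B (u + t) \<omega> - B u \<omega>)"
  have [measurable]: "B 0 \<in> borel_measurable (\<F> u)" "B u \<in> borel_measurable (\<F> u)"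
    using u brownian_adapted[of u] measurable_filtration_mono[OF brownian_adapted[of 0] u] by simp_all
  have W1F: "W1 \<in> borel_measurable (\<F> u)" unfolding W1_def by measurable
  have [measurable]: "W1 \<in> borel_measurable M" "W2 \<in> borel_measurable M"
    using u t measurable_from_filtration[OF W1F] increment_measurable[of u "u + t"] by (simp_all add: W2_def)
  have "indep_var borel W1 borel W2"
    unfolding W2_def using False t u by (intro increment_indep W1F) auto
  then have joint: "distr M (borel \<Otimes>\<^sub>M borel) (\<lambda>\<omega>. (W1 \<omega>, W2 \<omega>)) = distr M borel W1 \<Otimes>\<^sub>M distr M borel W2"
    by (simp add: indep_var_distribution_eq)
  interpret W2: prob_space "distr M borel W2" by (rule prob_space_distr) simp
  define f where "f a b = x * exp (s * a - s\<^sup>2 / 2 * u) * exp (s * b - s\<^sup>2 / 2 * t)" for a b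
  have f[measurable]: "(\<lambda>(a, b). indicator A (f a b) :: ennreal) \<in> borel_measurable (borel \<Otimes>\<^sub>M borel)"
    unfolding f_def by measurable
  have fW: "f (W1 \<omega>) (W2 \<omega>) = x * exp (s * (B (u + t) \<omega> - B 0 \<omega>) - s\<^sup>2 / 2 * (u + t))" for \<omega>
  proof -
    have "s * (B (u + t) \<omega> - B 0 \<omega>) - s\<^sup>2 / 2 * (u + t) =
        (s * W1 \<omega> - s\<^sup>2 / 2 * u) + (s * W2 \<omega> - s\<^sup>2 / 2 * t)"
      by (simp add: W1_def W2_def algebra_simps)
    then show ?thesis by (simp only: f_def exp_add mult.assoc)
  qed
  have "emeasure (lognormal_law s x (u + t)) A = (\<integral>\<^sup>+\<omega>. indicator A (f (W1 \<omega>) (W2 \<omega>)) \<partial>M)"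
    using lognormal_law_increment[of 0 "u + t" s x] u t increment_measurable[of 0 "u + t"]
    by (simp add: emeasure_distr_nn_integral fW)
  also have "\<dots> = (\<integral>\<^sup>+p. (case p of (a, b) \<Rightarrow> indicator A (f a b)) \<partial>distr M (borel \<Otimes>\<^sub>M borel) (\<lambda>\<omega>. (W1 \<omega>, W2 \<omega>)))"
    by (subst nn_integral_distr) simp_all
  also have "\<dots> = (\<integral>\<^sup>+a. \<integral>\<^sup>+b. indicator A (f a b) \<partial>distr M borel W2 \<partial>distr M borel W1)"
    unfolding joint by (subst W2.nn_integral_fst[symmetric]) simp_all
  also have "\<dots> = (\<integral>\<^sup>+a. emeasure (lognormal_law s (x * exp (s * a - s\<^sup>2 / 2 * u)) t) A \<partial>distr M borel W1)"
  proof (intro nn_integral_cong)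
    fix a
    have "(\<integral>\<^sup>+b. indicator A (f a b) \<partial>distr M borel W2) = (\<integral>\<^sup>+\<omega>. indicator A (f a (W2 \<omega>)) \<partial>M)"
      unfolding f_def by (subst nn_integral_distr) simp_all
    also have "\<dots> = emeasure (lognormal_law s (x * exp (s * a - s\<^sup>2 / 2 * u)) t) A"
      unfolding lognormal_law_increment[OF u t] using u t increment_measurable[of u "u + t"]
      by (simp add: emeasure_distr_nn_integral f_def W2_def)
    finally show "(\<integral>\<^sup>+b. indicator A (f a b) \<partial>distr M borel W2) =
      emeasure (lognormal_law s (x * exp (s * a - s\<^sup>2 / 2 * u)) t) A" .
  qed
  also have "\<dots> = (\<integral>\<^sup>+y. emeasure (lognormal_law s y t) A \<partial>lognormal_law s x u)"
  proof -
    interpret N: prob_space std_normal by (rule prob_space_std_normal)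
    have [measurable]: "(\<lambda>y. emeasure (lognormal_law s y t) A) \<in> borel_measurable borel"
      unfolding emeasure_lognormal_law[OF A] by measurable
    have eq: "lognormal_law s x u = distr M borel (\<lambda>\<omega>. x * exp (s * W1 \<omega> - s\<^sup>2 / 2 * u))"
      using lognormal_law_increment[of 0 u s x] u by (simp add: W1_def)
    show ?thesis unfolding eq by (simp add: nn_integral_distr)
  qed
  finally show ?thesis by simp
qed

text \<open>The event on \<open>X t\<close> belongs to \<open>\<F> t\<close>, of which
  \<open>T\<close> is independent, so the survival probability factors out; uniqueness then replaces
  \<open>X t\<close> by the exponential.\<close>

lemma active_in_linear_sde:
  assumes exit: "exit_time M \<F> lam T" and lam: "0 < lam" and s: "s \<noteq> 0" and t: "0 \<le> t"
    and X: "sde_solution M \<F> B (\<lambda>k. 0 * k) (\<lambda>k. s * k) x X" and A[measurable]: "A \<in> sets borel"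
  shows "active_in M T X t A = ennreal (exp (- lam * t)) * emeasure (lognormal_law s x t) A"
proof -
  have T: "distributed M lborel T (exponential_density lam)"
    and indep: "indep_set (sets (\<F> t)) (sets (vimage_algebra (space M) T borel))"
    using exit t by (simp_all add: exit_time_def)
  have XF: "X t \<in> borel_measurable (\<F> t)" using X t by (simp add: sde_solution_def)
  have [measurable]: "X t \<in> borel_measurable M" by (rule measurable_from_filtration[OF XF])
  have inc[measurable]: "(\<lambda>\<omega>. B t \<omega> - B 0 \<omega>) \<in> borel_measurable M"
    using t by (intro increment_measurable) auto
  have a: "{\<omega> \<in> space M. X t \<omega> \<in> A} \<in> sets (\<F> t)"
    using measurable_sets[OF XF A] by (simp add: vimage_def Int_def conj_commute space_F)
  have "{\<omega> \<in> space M. t < T \<omega>} = T -` {t<..} \<inter> space M" by auto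
  then have b: "{\<omega> \<in> space M. t < T \<omega>} \<in> sets (vimage_algebra (space M) T borel)"
    by (simp add: in_vimage_algebra)
  have "{\<omega> \<in> space M. t < T \<omega> \<and> X t \<omega> \<in> A} = {\<omega> \<in> space M. X t \<omega> \<in> A} \<inter> {\<omega> \<in> space M. t < T \<omega>}"
    by auto
  then have "active_in M T X t A = ennreal (prob {\<omega> \<in> space M. X t \<omega> \<in> A} * exp (- t * lam))"
    unfolding active_in_def emeasure_eq_measure
    using indep_setD[OF indep a b] exponential_distributedD_gt[OF T t lam] by simp
  also have "\<dots> = ennreal (exp (- lam * t)) * emeasure M {\<omega> \<in> space M. X t \<omega> \<in> A}"
    by (simp add: ennreal_mult emeasure_eq_measure mult.commute)
  also have "emeasure M {\<omega> \<in> space M. X t \<omega> \<in> A} =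
      emeasure M {\<omega> \<in> space M. x * exp (s * (B t \<omega> - B 0 \<omega>) - s\<^sup>2 / 2 * t) \<in> A}"
  proof (rule emeasure_eq_AE)
    show "AE \<omega> in M. \<omega> \<in> {\<omega> \<in> space M. X t \<omega> \<in> A} \<longleftrightarrow>
      \<omega> \<in> {\<omega> \<in> space M. x * exp (s * (B t \<omega> - B 0 \<omega>) - s\<^sup>2 / 2 * t) \<in> A}"
      using linear_sde_unique[OF s t X geometric_sde_solution] geometric_eq_increment[of s x t]
      by eventually_elim simp
  qed measurable
  also have "\<dots> = emeasure (lognormal_law s x t) A"
    using lognormal_law_increment[of 0 t s x] t
    by (simp add: emeasure_distr vimage_def Int_def conj_commute)
  finally show ?thesis .
qed

end

section \<open>Brownian motion at an exponential time\<close>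

definition exponential_law :: "real \<Rightarrow> real measure" where
  "exponential_law lam = density lborel (exponential_density lam)"

lemma sets_exponential_law[simp, measurable_cong]: "sets (exponential_law lam) = sets borel"
  by (simp add: exponential_law_def)

lemma prob_space_exponential_law: "0 < lam \<Longrightarrow> prob_space (exponential_law lam)"
  unfolding exponential_law_def by (rule prob_space_exponential_density)

text \<open>The fundamental theorem of calculus with antiderivative
  \<open>- exp (- c * u) / c\<close>, dominated by a multiple of the exponential density of rate
  \<open>Re c\<close>. Complex \<open>c\<close> serves both the mixture over exponential times and
  the Fourier integrals of the Laplace density.\<close>

lemma has_bochner_integral_exp_half_line:
  fixes c :: complex
  assumes c: "0 < Re c"
  shows "has_bochner_integral lborel (\<lambda>u. indicator {0..} u *\<^sub>R exp (- c * of_real u)) (1 / c)"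
proof -
  have c0: "c \<noteq> 0" using c by auto
  have dom: "integrable lborel (\<lambda>u. exponential_density (Re c) u / Re c)"
  proof (intro integrable_divide integrableI_nonneg)
    have "(\<integral>\<^sup>+u. ennreal (exponential_density (Re c) u) \<partial>lborel) = 1"
      using prob_space.emeasure_space_1[OF prob_space_exponential_density[OF c]]
      by (simp add: emeasure_density)
    then show "(\<integral>\<^sup>+u. ennreal (exponential_density (Re c) u) \<partial>lborel) < \<infinity>" by simp
  qed (use c in auto)
  have "integrable lborel (\<lambda>u. indicator {0<..} u *\<^sub>R exp (- c * of_real u))"
  proof (rule Bochner_Integration.integrable_bound[OF dom])
    show "AE u in lborel. norm (indicator {0<..} u *\<^sub>R exp (- c * of_real u)) \<le>
        norm (exponential_density (Re c) u / Re c)"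
      using c by (intro AE_I2) (auto simp: exponential_density_def indicator_def mult.commute)
  qed measurable
  then have int: "set_integrable lborel (einterval 0 \<infinity>) (\<lambda>u. exp (- c * of_real u))"
    by (simp add: set_integrable_def zero_ereal_def)
  define F where "F u = - exp (- c * of_real u) / c" for u :: real
  have "(LBINT u=0..\<infinity>. exp (- c * of_real u)) = 0 - F 0"
  proof (rule interval_integral_FTC_integrable[OF _ _ _ int])
    fix u :: real
    have "((\<lambda>z. - exp (- c * z) / c) has_field_derivative exp (- c * of_real u)) (at (of_real u))"
      using c0 by (auto intro!: derivative_eq_intros)
    then show "(F has_vector_derivative exp (- c * of_real u)) (at u)"
      unfolding F_def[abs_def] by (rule has_vector_derivative_real_field)
    show "isCont (\<lambda>u. exp (- c * of_real u)) u" by (intro continuous_intros)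
  next
    have "continuous_on UNIV F" unfolding F_def[abs_def] using c0 by (intro continuous_intros) auto
    then have "(F \<longlongrightarrow> F 0) (at 0)" by (simp add: continuous_on_def)
    then have "(F \<longlongrightarrow> F 0) (at_right 0)" by (rule tendsto_within_subset) simp
    then show "((F \<circ> real_of_ereal) \<longlongrightarrow> F 0) (at_right 0)"
      by (simp add: zero_ereal_def ereal_tendsto_simps)
    have "((\<lambda>u. exp (- (Re c * u)) / norm c) \<longlongrightarrow> 0 / norm c) at_top"
      using c by (intro tendsto_divide tendsto_const filterlim_compose[OF exp_at_bot]
          filterlim_compose[OF filterlim_uminus_at_bot_at_top]
          filterlim_tendsto_pos_mult_at_top[OF tendsto_const _ filterlim_ident]) (use c0 in auto)
    then have "((\<lambda>u. norm (F u)) \<longlongrightarrow> 0) at_top"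
      by (simp add: F_def norm_divide)
    then have "(F \<longlongrightarrow> 0) at_top" by (simp add: tendsto_norm_zero_iff)
    then show "((F \<circ> real_of_ereal) \<longlongrightarrow> 0) (at_left \<infinity>)"
      by (simp add: ereal_tendsto_simps)
  qed simp
  then have val: "(\<integral>u. indicator {0<..} u *\<^sub>R exp (- c * of_real u) \<partial>lborel) = 1 / c"
    by (simp add: interval_lebesgue_integral_0_infty set_lebesgue_integral_def F_def)
  have open_half: "has_bochner_integral lborel (\<lambda>u. indicator {0<..} u *\<^sub>R exp (- c * of_real u)) (1 / c)"
    using \<open>integrable lborel (\<lambda>u. indicator {0<..} u *\<^sub>R exp (- c * of_real u))\<close> val
    by (simp add: has_bochner_integral_iff)
  \<comment> \<open>The integral was computed over the open half-line; the endpoint 0 is a null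
    set.\<close>
  have "AE u in lborel. indicator {0<..} u *\<^sub>R exp (- c * of_real u) =
      indicator {0..} u *\<^sub>R exp (- c * of_real u)"
    using AE_lborel_singleton[of 0] by eventually_elim (auto simp: indicator_def)
  then show ?thesis
    by (rule iffD1[OF has_bochner_integral_cong_AE open_half, rotated 2]) measurable
qed

lemma laplace_transform_exponential_law:
  fixes c :: complex
  assumes lam: "0 < lam" and c: "0 \<le> Re c"
  shows "(\<integral>u. exp (- c * of_real u) \<partial>exponential_law lam) = of_real lam / (of_real lam + c)"
proof -
  have "(\<integral>u. exp (- c * of_real u) \<partial>exponential_law lam) =
      (\<integral>u. exponential_density lam u *\<^sub>R exp (- c * of_real u) \<partial>lborel)"
    unfolding exponential_law_def
    by (intro integral_density) (use exponential_density_nonneg[OF lam] in auto)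
  also have "\<dots> = (\<integral>u. of_real lam * (indicator {0..} u *\<^sub>R exp (- (of_real lam + c) * of_real u)) \<partial>lborel)"
  proof (intro Bochner_Integration.integral_cong refl)
    fix u
    have "complex_of_real (exp (- u * lam)) * exp (- c * of_real u) = exp (- (of_real lam + c) * of_real u)"
      by (simp add: exp_of_real[symmetric] mult_exp_exp algebra_simps)
    then show "exponential_density lam u *\<^sub>R exp (- c * of_real u) =
        of_real lam * (indicator {0..} u *\<^sub>R exp (- (of_real lam + c) * of_real u))"
      by (auto simp: exponential_density_def indicator_def scaleR_conv_of_real mult.assoc)
  qed
  also have "\<dots> = of_real lam / (of_real lam + c)"
  proof -
    have "0 < Re (of_real lam + c)" using lam c by simp
    from has_bochner_integral_integral_eq[OF has_bochner_integral_mult_right[OF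
        has_bochner_integral_exp_half_line[OF this], of "of_real lam"]]
    show ?thesis by simp
  qed
  finally show ?thesis .
qed

text \<open>The law of \<open>s W\<^sub>U - s\<^sup>2 U / 2\<close> for a Brownian motion \<open>W\<close> and an independent exponential
  time \<open>U\<close>.\<close>

definition log_wealth_law :: "real \<Rightarrow> real \<Rightarrow> real measure" where
  "log_wealth_law s lam = distr (exponential_law lam \<Otimes>\<^sub>M std_normal) borel
    (\<lambda>(u, z). s * (sqrt u * z) - s\<^sup>2 / 2 * u)"

lemma sets_log_wealth_law[simp, measurable_cong]: "sets (log_wealth_law s lam) = sets borel"
  by (simp add: log_wealth_law_def)

lemma real_distribution_log_wealth_law:
  assumes "0 < lam"
  shows "real_distribution (log_wealth_law s lam)"
proof -
  interpret E: prob_space "exponential_law lam" by (rule prob_space_exponential_law[OF assms])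
  interpret N: prob_space std_normal by (rule prob_space_std_normal)
  interpret pair_prob_space "exponential_law lam" std_normal ..
  show ?thesis unfolding log_wealth_law_def by (rule real_distribution_distr) measurable
qed

text \<open>Given the time \<open>u\<close>, the variable is normal with mean
  \<open>- s\<^sup>2 * u / 2\<close> and variance \<open>s\<^sup>2 * u\<close>, so its
  characteristic function is \<open>exp (- c * u)\<close>. Averaging over \<open>u\<close> evaluates
  the Laplace transform of the exponential law at \<open>c\<close>, whose real part is
  nonnegative.\<close>

lemma char_log_wealth_law:
  assumes lam: "0 < lam"
  shows "char (log_wealth_law s lam) \<zeta> = of_real lam / (of_real lam + (s\<^sup>2 / 2) *\<^sub>R (\<i> * \<zeta> + \<zeta>\<^sup>2))"
proof -
  interpret E: prob_space "exponential_law lam" by (rule prob_space_exponential_law[OF lam])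
  interpret N: prob_space std_normal by (rule prob_space_std_normal)
  interpret pair_prob_space "exponential_law lam" std_normal ..
  define c :: complex where "c = (s\<^sup>2 / 2) *\<^sub>R (\<i> * \<zeta> + \<zeta>\<^sup>2)"
  define f where "f p = iexp (\<zeta> * (s * (sqrt (fst p) * snd p) - s\<^sup>2 / 2 * fst p))" for p
  have [measurable]: "f \<in> borel_measurable (exponential_law lam \<Otimes>\<^sub>M std_normal)"
    unfolding f_def[abs_def] by measurable
  have int: "integrable (exponential_law lam \<Otimes>\<^sub>M std_normal) f"
    by (rule integrable_const_bound[where B = 1]) (auto simp: f_def)
  have "char (log_wealth_law s lam) \<zeta> = (\<integral>p. f p \<partial>(exponential_law lam \<Otimes>\<^sub>M std_normal))"
    unfolding char_def log_wealth_law_def f_def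
    by (subst integral_distr) (measurable, simp add: case_prod_beta)
  also have "\<dots> = (\<integral>u. \<integral>z. f (u, z) \<partial>std_normal \<partial>exponential_law lam)"
    by (rule integral_fst'[OF int, symmetric])
  also have "\<dots> = (\<integral>u. exp (- c * of_real u) \<partial>exponential_law lam)"
  proof (rule integral_cong_AE)
    have "AE u in exponential_law lam. 0 \<le> u"
      unfolding exponential_law_def by (subst AE_density) (auto simp: exponential_density_def)
    then show "AE u in exponential_law lam. (\<integral>z. f (u, z) \<partial>std_normal) = exp (- c * of_real u)"
    proof eventually_elim
      case (elim u)
      have "f (u, z) = iexp (- (\<zeta> * s\<^sup>2 / 2 * u)) * iexp ((\<zeta> * s * sqrt u) * z)" for z
        by (simp add: f_def mult_exp_exp algebra_simps)
      then have "(\<integral>z. f (u, z) \<partial>std_normal) =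
          iexp (- (\<zeta> * s\<^sup>2 / 2 * u)) * char std_normal (\<zeta> * s * sqrt u)"
        by (simp add: char_def)
      also have "\<dots> = exp (- c * of_real u)"
        using elim by (simp add: char_std_normal_distribution exp_of_real[symmetric] mult_exp_exp c_def
            power_mult_distrib scaleR_conv_of_real add_divide_distrib diff_divide_distrib algebra_simps
            flip: of_real_power of_real_mult)
      finally show ?case .
    qed
  qed measurable
  also have "\<dots> = of_real lam / (of_real lam + c)"
    by (rule laplace_transform_exponential_law[OF lam]) (simp add: c_def power2_eq_square flip: of_real_mult)
  finally show ?thesis by (simp add: c_def)
qed

section \<open>The asymmetric Laplace law\<close>

text \<open>The double Pareto density in the coordinate \<open>y = ln (x / K)\<close>, including the
  Jacobian; the common factor gives mass one for positive parameters and makes the branches meet at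
  0.\<close>

definition laplace_density :: "real \<Rightarrow> real \<Rightarrow> real \<Rightarrow> real" where
  "laplace_density \<alpha> \<kappa> y = \<alpha> * \<kappa> / (\<alpha> + \<kappa>) * (if y < 0 then exp (\<kappa> * y) else exp (- (\<alpha> * y)))"

lemma laplace_density_measurable[measurable]: "laplace_density \<alpha> \<kappa> \<in> borel_measurable borel"
  unfolding laplace_density_def[abs_def] by measurable

lemma laplace_density_nonneg: "0 < \<alpha> \<Longrightarrow> 0 < \<kappa> \<Longrightarrow> 0 \<le> laplace_density \<alpha> \<kappa> y"
  by (simp add: laplace_density_def)

text \<open>The half-lines contribute \<open>1 / a\<close> and \<open>1 / k\<close>. In
  \<open>a + k\<close> the frequency cancels, so the sum is
  \<open>(\<alpha> + \<kappa>) / (a * k)\<close> and the normalising factor removes the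
  numerator.\<close>

lemma has_bochner_integral_laplace_density:
  assumes "0 < \<alpha>" "0 < \<kappa>"
  shows "has_bochner_integral lborel (\<lambda>y. laplace_density \<alpha> \<kappa> y *\<^sub>R iexp (\<zeta> * y))
    (of_real (\<alpha> * \<kappa>) / ((\<alpha> - \<i> * \<zeta>) * (\<kappa> + \<i> * \<zeta>)))"
proof -
  define a where "a = \<alpha> - \<i> * \<zeta>"
  define k where "k = \<kappa> + \<i> * \<zeta>"
  have re: "0 < Re a" "0 < Re k" using assms by (simp_all add: a_def k_def)
  have nz: "a \<noteq> 0" "k \<noteq> 0" "complex_of_real \<alpha> + of_real \<kappa> \<noteq> 0"
    using re assms by (auto simp flip: of_real_add)
  have "has_bochner_integral lborel (\<lambda>y. indicator {0..} y *\<^sub>R exp (- k * of_real y)) (1 / k)"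
    by (rule has_bochner_integral_exp_half_line[OF re(2)])
  then have "has_bochner_integral lborel (\<lambda>y. indicator {0..} (- y) *\<^sub>R exp (- k * of_real (- y))) (1 / k)"
    by (subst (asm) lborel_has_bochner_integral_real_affine_iff[where c = "- 1" and t = 0]) simp_all
  then have mixture: "has_bochner_integral lborel (\<lambda>y. (\<alpha> * \<kappa> / (\<alpha> + \<kappa>)) *\<^sub>R
      (indicator {0..} y *\<^sub>R exp (- a * of_real y) + indicator {0..} (- y) *\<^sub>R exp (- k * of_real (- y))))
      ((\<alpha> * \<kappa> / (\<alpha> + \<kappa>)) *\<^sub>R (1 / a + 1 / k))"
    using has_bochner_integral_exp_half_line[OF re(1)]
    by (intro has_bochner_integral_scaleR_right has_bochner_integral_add) auto
  have "AE y in lborel. (\<alpha> * \<kappa> / (\<alpha> + \<kappa>)) *\<^sub>R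
      (indicator {0..} y *\<^sub>R exp (- a * of_real y) + indicator {0..} (- y) *\<^sub>R exp (- k * of_real (- y))) =
      laplace_density \<alpha> \<kappa> y *\<^sub>R iexp (\<zeta> * y)"
    using AE_lborel_singleton[of 0]
  proof eventually_elim
    case (elim y)
    have "exp (- a * of_real y) = complex_of_real (exp (- (\<alpha> * y))) * iexp (\<zeta> * y)"
      "exp (- k * of_real (- y)) = complex_of_real (exp (\<kappa> * y)) * iexp (\<zeta> * y)"
      by (simp_all add: a_def k_def exp_of_real[symmetric] mult_exp_exp algebra_simps)
    then show ?case using elim
      by (auto simp: laplace_density_def indicator_def scaleR_conv_of_real)
  qed
  then have "has_bochner_integral lborel (\<lambda>y. laplace_density \<alpha> \<kappa> y *\<^sub>R iexp (\<zeta> * y))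
      ((\<alpha> * \<kappa> / (\<alpha> + \<kappa>)) *\<^sub>R (1 / a + 1 / k))"
    by (rule iffD1[OF has_bochner_integral_cong_AE mixture, rotated 2]) measurable
  also have "(\<alpha> * \<kappa> / (\<alpha> + \<kappa>)) *\<^sub>R (1 / a + 1 / k) = of_real (\<alpha> * \<kappa>) / (a * k)"
  proof -
    have "a + k = of_real \<alpha> + of_real \<kappa>" by (simp add: a_def k_def)
    then have "1 / a + 1 / k = (of_real \<alpha> + of_real \<kappa>) / (a * k)"
      using nz by (simp add: field_simps)
    then show ?thesis using nz by (simp add: scaleR_conv_of_real)
  qed
  finally show ?thesis by (simp add: a_def k_def)
qed

text \<open>Total mass one is the preceding integral at frequency 0.\<close>

lemma real_distribution_laplace:
  assumes "0 < \<alpha>" "0 < \<kappa>"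
  shows "real_distribution (density lborel (laplace_density \<alpha> \<kappa>))"
proof -
  have "has_bochner_integral lborel (\<lambda>y. complex_of_real (laplace_density \<alpha> \<kappa> y)) 1"
    using has_bochner_integral_laplace_density[OF assms, of 0] assms by (simp add: scaleR_conv_of_real)
  from has_bochner_integral_bounded_linear[OF bounded_linear_Re this]
  have "has_bochner_integral lborel (laplace_density \<alpha> \<kappa>) 1" by simp
  then have "(\<integral>\<^sup>+y. ennreal (laplace_density \<alpha> \<kappa> y) \<partial>lborel) = 1"
    using nn_integral_eq_integral[of lborel "laplace_density \<alpha> \<kappa>"] laplace_density_nonneg[OF assms]
    by (simp add: has_bochner_integral_iff)
  then have "prob_space (density lborel (laplace_density \<alpha> \<kappa>))"
    by (intro prob_spaceI) (simp add: emeasure_density)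
  then show ?thesis
    by (simp add: real_distribution_def real_distribution_axioms_def)
qed

text \<open>The characteristic function of the logarithm of wealth has the denominator
  \<open>lam + s\<^sup>2 (\<zeta>\<^sup>2 + i \<zeta>) / 2\<close>, which splits as \<open>s\<^sup>2 / 2 * (\<alpha> - i \<zeta>) * (\<kappa> + i \<zeta>)\<close> exactly when
  \<open>\<alpha> - \<kappa> = 1\<close> and \<open>\<alpha> \<kappa> = 2 lam / s\<^sup>2\<close>.\<close>

lemma log_wealth_law_eq_laplace:
  assumes lam: "0 < lam" and s: "s \<noteq> 0" and pos: "0 < \<alpha>" "0 < \<kappa>"
    and \<kappa>: "\<kappa> = \<alpha> - 1" and prod: "\<alpha> * \<kappa> = 2 * lam / s\<^sup>2"
  shows "log_wealth_law s lam = density lborel (laplace_density \<alpha> \<kappa>)"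
proof (rule Levy_uniqueness[OF real_distribution_log_wealth_law[OF lam] real_distribution_laplace[OF pos]], rule ext)
  fix \<zeta> :: real
  have lam_eq: "lam = s\<^sup>2 / 2 * (\<alpha> * \<kappa>)" using prod s by simp
  have split: "of_real lam + (s\<^sup>2 / 2) *\<^sub>R (\<i> * \<zeta> + \<zeta>\<^sup>2) =
      of_real (s\<^sup>2 / 2) * ((\<alpha> - \<i> * \<zeta>) * (\<kappa> + \<i> * \<zeta>))"
  proof -
    have "(\<alpha> - \<i> * \<zeta>) * (\<kappa> + \<i> * \<zeta>) = of_real (\<alpha> * \<kappa>) + (\<i> * \<zeta> + \<zeta>\<^sup>2)"
      by (simp add: \<kappa> algebra_simps power2_eq_square)
    then show ?thesis
      unfolding lam_eq by (simp only: scaleR_conv_of_real distrib_left of_real_mult)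
  qed
  have "char (density lborel (laplace_density \<alpha> \<kappa>)) \<zeta> =
      (\<integral>y. laplace_density \<alpha> \<kappa> y *\<^sub>R iexp (\<zeta> * y) \<partial>lborel)"
    unfolding char_def by (intro integral_density) (simp_all add: laplace_density_nonneg[OF pos])
  also have "\<dots> = of_real (\<alpha> * \<kappa>) / ((\<alpha> - \<i> * \<zeta>) * (\<kappa> + \<i> * \<zeta>))"
    by (rule has_bochner_integral_integral_eq[OF has_bochner_integral_laplace_density[OF pos]])
  also have "\<dots> = char (log_wealth_law s lam) \<zeta>"
    unfolding char_log_wealth_law[OF lam] split using s by (simp add: lam_eq)
  finally show "char (log_wealth_law s lam) \<zeta> = char (density lborel (laplace_density \<alpha> \<kappa>)) \<zeta>" ..
qed

section \<open>From log wealth back to wealth\<close>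

text \<open>The substitution is made on compact intervals, whose images under
  \<open>K * exp y\<close> exhaust the positive half-line; monotone convergence passes to the limit
  on both sides.\<close>

lemma nn_integral_exp_substitution:
  fixes f :: "real \<Rightarrow> real"
  assumes [measurable]: "f \<in> borel_measurable borel" and K: "0 < K"
  shows "(\<integral>\<^sup>+x. ennreal (f x) * indicator {0<..} x \<partial>lborel) = (\<integral>\<^sup>+y. ennreal (f (K * exp y) * (K * exp y)) \<partial>lborel)"
proof -
  define g where "g y = K * exp y" for y :: real
  let ?I = "\<lambda>n. {g (- real n)..g (real n)}"
  have eq: "(\<integral>\<^sup>+x. ennreal (f x) * indicator (?I n) x \<partial>lborel) =
      (\<integral>\<^sup>+y. ennreal (f (g y) * g y) * indicator {- real n..real n} y \<partial>lborel)" for n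
  proof -
    have "(\<integral>\<^sup>+x. f x * indicator (?I n) x \<partial>lborel) = (\<integral>\<^sup>+y. f (g y) * g y * indicator {- real n..real n} y \<partial>lborel)"
      using K by (intro nn_integral_substitution)
        (auto simp: g_def set_borel_measurable_def intro!: derivative_eq_intros continuous_intros)
    then show ?thesis by (simp add: nn_integral_set_ennreal)
  qed
  have mono: "g (- real j) \<le> g (- real i)" "g (real i) \<le> g (real j)" if "i \<le> j" for i j
    using K that by (simp_all add: g_def)
  have "(\<lambda>n. \<integral>\<^sup>+x. ennreal (f x) * indicator (?I n) x \<partial>lborel) \<longlonglongrightarrow> (\<integral>\<^sup>+x. ennreal (f x) * indicator {0<..} x \<partial>lborel)"
  proof (rule nn_integral_LIMSEQ)
    show "incseq (\<lambda>n x. ennreal (f x) * indicator (?I n) x)"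
      unfolding incseq_def le_fun_def
    proof (intro allI impI)
      fix m n :: nat and x assume "m \<le> n"
      from mono[OF this] have "x \<in> ?I m \<Longrightarrow> x \<in> ?I n" by simp
      then show "ennreal (f x) * indicator (?I m) x \<le> ennreal (f x) * indicator (?I n) x"
        by (simp only: indicator_def) (simp split: if_splits)
    qed
    fix x :: real
    show "(\<lambda>n. ennreal (f x) * indicator (?I n) x) \<longlonglongrightarrow> ennreal (f x) * indicator {0<..} x"
    proof (cases "0 < x")
      case True
      obtain n0 :: nat where n0: "\<bar>ln (x / K)\<bar> \<le> real n0" using real_arch_simple by blast
      have x: "x = g (ln (x / K))" using True K by (simp add: g_def)
      have "x \<in> ?I n" if "n0 \<le> n" for n
        using n0 that K by (subst (1) x, unfold g_def) (auto simp: mult_le_cancel_left)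
      then have "\<forall>\<^sub>F n in sequentially. ennreal (f x) * indicator (?I n) x = ennreal (f x) * indicator {0<..} x"
        using True by (intro eventually_sequentiallyI[of n0]) simp
      then show ?thesis by (rule tendsto_eventually)
    next
      case False
      have "x \<notin> ?I n" for n
      proof
        assume "x \<in> ?I n"
        moreover have "0 < g (- real n)" using K by (simp add: g_def)
        ultimately show False using False by simp
      qed
      then show ?thesis using False by simp
    qed
  qed measurable
  moreover have "(\<lambda>n. \<integral>\<^sup>+y. ennreal (f (g y) * g y) * indicator {- real n..real n} y \<partial>lborel) \<longlonglongrightarrow>
      (\<integral>\<^sup>+y. ennreal (f (g y) * g y) \<partial>lborel)"
  proof (rule nn_integral_LIMSEQ)
    show "incseq (\<lambda>n y. ennreal (f (g y) * g y) * indicator {- real n..real n} y)"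
      by (auto simp: incseq_def le_fun_def indicator_def)
    show "(\<lambda>y. ennreal (f (g y) * g y) * indicator {- real n..real n} y) \<in> borel_measurable lborel" for n
      unfolding g_def by measurable
    fix y :: real
    obtain n0 :: nat where n0: "\<bar>y\<bar> \<le> real n0" using real_arch_simple by blast
    have "y \<in> {- real n..real n}" if "n0 \<le> n" for n
    proof -
      have "real n0 \<le> real n" using that by simp
      then show ?thesis using n0 by (simp add: abs_le_iff)
    qed
    then have "\<forall>\<^sub>F n in sequentially. ennreal (f (g y) * g y) * indicator {- real n..real n} y = ennreal (f (g y) * g y)"
      by (intro eventually_sequentiallyI[of n0]) (simp del: atLeastAtMost_iff)
    then show "(\<lambda>n. ennreal (f (g y) * g y) * indicator {- real n..real n} y) \<longlonglongrightarrow> ennreal (f (g y) * g y)"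
      by (rule tendsto_eventually)
  qed
  ultimately show ?thesis
    unfolding eq by (simp add: LIMSEQ_unique g_def[symmetric])
qed

lemma double_pareto_density_measurable[measurable]:
  "double_pareto_density x\<^sub>0 \<alpha> \<kappa> \<in> borel_measurable borel"
  unfolding double_pareto_density_def[abs_def] by measurable

text \<open>The Jacobian \<open>K * exp y\<close> raises the powers \<open>\<kappa> - 1\<close> and
  \<open>- \<alpha> - 1\<close> to \<open>\<kappa>\<close> and \<open>- \<alpha>\<close>. At the
  break point both densities use their upper branch.\<close>

lemma double_pareto_density_exp:
  assumes "0 < K"
  shows "double_pareto_density K \<alpha> \<kappa> (K * exp y) * (K * exp y) = laplace_density \<alpha> \<kappa> y"
proof -
  have "exp (y * (\<kappa> - 1)) * exp y = exp (\<kappa> * y)" "exp (y * (- \<alpha> - 1)) * exp y = exp (- (\<alpha> * y))"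
    by (simp_all add: mult_exp_exp algebra_simps)
  then show ?thesis
    using assms by (simp add: double_pareto_density_def laplace_density_def powr_def mult_less_0_iff
        mult_le_0_iff not_le ac_simps)
qed

lemma laplace_exp_eq_double_pareto:
  assumes K: "0 < K"
  shows "distr (density lborel (laplace_density \<alpha> \<kappa>)) borel (\<lambda>y. K * exp y) =
    density lborel (double_pareto_density K \<alpha> \<kappa>)"
proof (rule measure_eqI)
  fix A assume "A \<in> sets (distr (density lborel (laplace_density \<alpha> \<kappa>)) borel (\<lambda>y. K * exp y))"
  then have [measurable]: "A \<in> sets borel" by simp
  let ?p = "double_pareto_density K \<alpha> \<kappa>"
  have "emeasure (density lborel ?p) A = (\<integral>\<^sup>+x. ennreal (?p x * indicator A x) * indicator {0<..} x \<partial>lborel)"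
    by (simp add: emeasure_density)
      (intro nn_integral_cong, auto simp: indicator_def double_pareto_density_def)
  also have "\<dots> = (\<integral>\<^sup>+y. ennreal (?p (K * exp y) * indicator A (K * exp y) * (K * exp y)) \<partial>lborel)"
    by (rule nn_integral_exp_substitution[OF _ K]) measurable
  also have "\<dots> = (\<integral>\<^sup>+y. ennreal (laplace_density \<alpha> \<kappa> y) * indicator A (K * exp y) \<partial>lborel)"
  proof (intro nn_integral_cong)
    fix y
    show "ennreal (?p (K * exp y) * indicator A (K * exp y) * (K * exp y)) =
      ennreal (laplace_density \<alpha> \<kappa> y) * indicator A (K * exp y)"
      unfolding double_pareto_density_exp[OF K, symmetric] by (auto simp: indicator_def)
  qed
  also have "\<dots> = emeasure (distr (density lborel (laplace_density \<alpha> \<kappa>)) borel (\<lambda>y. K * exp y)) A"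
    by (subst emeasure_distr_nn_integral) (simp_all add: nn_integral_density)
  finally show "emeasure (distr (density lborel (laplace_density \<alpha> \<kappa>)) borel (\<lambda>y. K * exp y)) A =
    emeasure (density lborel ?p) A" ..
qed simp

section \<open>The stationary cross-section\<close>

text \<open>With exits at rate \<open>lam\<close> replaced at once, the stationary age of an active
  entrepreneur is exponential; this is the law of capital at such an age after entry with
  \<open>K\<close>.\<close>

definition wealth_law :: "real \<Rightarrow> real \<Rightarrow> real \<Rightarrow> real measure" where
  "wealth_law s lam K = distr (log_wealth_law s lam) borel (\<lambda>y. K * exp y)"

lemma sets_wealth_law[simp, measurable_cong]: "sets (wealth_law s lam K) = sets borel"
  by (simp add: wealth_law_def)

lemma prob_space_wealth_law: "0 < lam \<Longrightarrow> prob_space (wealth_law s lam K)"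
  unfolding wealth_law_def
  by (intro prob_space.prob_space_distr real_distribution.axioms(1)[OF real_distribution_log_wealth_law]) auto

lemma nn_integral_exponential_law:
  assumes lam: "0 < lam" and [measurable]: "g \<in> borel_measurable borel"
  shows "(\<integral>\<^sup>+u. g u \<partial>exponential_law lam) = (\<integral>\<^sup>+u\<in>{0..}. ennreal (lam * exp (- lam * u)) * g u \<partial>lborel)"
  unfolding exponential_law_def
  by (subst nn_integral_density)
    (auto intro!: nn_integral_cong simp: exponential_density_def indicator_def mult.commute)

lemma nn_integral_lognormal_law:
  assumes "h \<in> borel_measurable borel"
  shows "(\<integral>\<^sup>+x. h x \<partial>lognormal_law s x t) =
    (\<integral>\<^sup>+z. h (x * exp (s * (sqrt t * z) - s\<^sup>2 / 2 * t)) \<partial>std_normal)"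
  unfolding lognormal_law_def by (rule nn_integral_distr) (use assms in simp_all)

lemma nn_integral_lognormal_law_measurable[measurable]:
  assumes [measurable]: "h \<in> borel_measurable borel"
  shows "(\<lambda>t. \<integral>\<^sup>+x. h x \<partial>lognormal_law s y t) \<in> borel_measurable borel"
proof -
  interpret N: prob_space std_normal by (rule prob_space_std_normal)
  show ?thesis unfolding nn_integral_lognormal_law[OF assms] by measurable
qed

lemma emeasure_lognormal_law_measurable:
  assumes A[measurable]: "A \<in> sets borel"
  shows "(\<lambda>t. emeasure (lognormal_law s x t) A) \<in> borel_measurable borel"
    and "(\<lambda>x. emeasure (lognormal_law s x t) A) \<in> borel_measurable borel"
proof -
  interpret N: prob_space std_normal by (rule prob_space_std_normal)
  show "(\<lambda>t. emeasure (lognormal_law s x t) A) \<in> borel_measurable borel"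
    "(\<lambda>x. emeasure (lognormal_law s x t) A) \<in> borel_measurable borel"
    unfolding emeasure_lognormal_law[OF A] by measurable
qed

lemma nn_integral_wealth_law:
  assumes h[measurable]: "h \<in> borel_measurable borel"
  shows "(\<integral>\<^sup>+x. h x \<partial>wealth_law s lam K) =
    (\<integral>\<^sup>+u. \<integral>\<^sup>+x. h x \<partial>lognormal_law s K u \<partial>exponential_law lam)"
proof -
  interpret N: prob_space std_normal by (rule prob_space_std_normal)
  have "(\<integral>\<^sup>+x. h x \<partial>wealth_law s lam K) =
      (\<integral>\<^sup>+p. h (K * exp (s * (sqrt (fst p) * snd p) - s\<^sup>2 / 2 * fst p)) \<partial>(exponential_law lam \<Otimes>\<^sub>M std_normal))"
    unfolding wealth_law_def log_wealth_law_def by (simp add: nn_integral_distr case_prod_beta)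
  also have "\<dots> = (\<integral>\<^sup>+u. \<integral>\<^sup>+z. h (K * exp (s * (sqrt u * z) - s\<^sup>2 / 2 * u)) \<partial>std_normal \<partial>exponential_law lam)"
    by (subst N.nn_integral_fst[symmetric]) simp_all
  finally show ?thesis by (simp only: nn_integral_lognormal_law[OF h])
qed

lemma emeasure_wealth_law:
  assumes lam: "0 < lam" and A[measurable]: "A \<in> sets borel"
  shows "emeasure (wealth_law s lam K) A =
    (\<integral>\<^sup>+u\<in>{0..}. ennreal (lam * exp (- lam * u)) * emeasure (lognormal_law s K u) A \<partial>lborel)"
proof -
  note [measurable] = emeasure_lognormal_law_measurable[OF A]
  have "emeasure (wealth_law s lam K) A = (\<integral>\<^sup>+x. indicator A x \<partial>wealth_law s lam K)" by simp
  also have "\<dots> = (\<integral>\<^sup>+u. emeasure (lognormal_law s K u) A \<partial>exponential_law lam)"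
    by (subst nn_integral_wealth_law) simp_all
  finally show ?thesis by (simp add: nn_integral_exponential_law[OF lam])
qed

lemma wealth_law_positive:
  assumes lam: "0 < lam" and K: "0 < K"
  shows "emeasure (wealth_law s lam K) {0<..} = 1"
proof -
  interpret prob_space "log_wealth_law s lam"
    by (rule real_distribution.axioms(1)[OF real_distribution_log_wealth_law[OF lam]])
  show ?thesis
    using K emeasure_space_1 by (simp add: wealth_law_def emeasure_distr_nn_integral)
qed

text \<open>Each lognormal law started at \<open>K\<close> has mean \<open>K\<close>, since the
  compensator cancels the Gaussian exponential moment; a mixture keeps the mean. Thus entry at
  \<open>K\<close> agrees with entry at average capital.\<close>

lemma wealth_law_mean:
  assumes lam: "0 < lam" and K: "0 < K"
  shows "integrable (wealth_law s lam K) (\<lambda>x. x)" "(\<integral>x. x \<partial>wealth_law s lam K) = K"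
proof -
  interpret prob_space "wealth_law s lam K" by (rule prob_space_wealth_law[OF lam])
  interpret E: prob_space "exponential_law lam" by (rule prob_space_exponential_law[OF lam])
  \<comment> \<open>The cancellation uses \<open>(sqrt u)\<^sup>2 = u\<close>, hence nonnegative
    times.\<close>
  have AE: "AE u in exponential_law lam. 0 \<le> u"
    unfolding exponential_law_def by (subst AE_density) (auto simp: exponential_density_def)
  have "(\<integral>\<^sup>+x. ennreal x \<partial>wealth_law s lam K) = (\<integral>\<^sup>+u. \<integral>\<^sup>+x. ennreal x \<partial>lognormal_law s K u \<partial>exponential_law lam)"
    by (rule nn_integral_wealth_law) simp
  also have "\<dots> = (\<integral>\<^sup>+u. ennreal K \<partial>exponential_law lam)"
  proof (rule nn_integral_cong_AE, use AE in eventually_elim)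
    fix u :: real assume u: "0 \<le> u"
    have eq: "K * exp (s * (sqrt u * z) - s\<^sup>2 / 2 * u) = K * exp (- (s\<^sup>2 / 2 * u)) * exp ((s * sqrt u) * z)" for z
      by (simp add: mult_exp_exp mult.assoc)
    have int: "integrable std_normal (\<lambda>z. K * exp (s * (sqrt u * z) - s\<^sup>2 / 2 * u))"
      unfolding eq by (intro integrable_mult_right std_normal_exp)
    have "(\<integral>z. K * exp (s * (sqrt u * z) - s\<^sup>2 / 2 * u) \<partial>std_normal) = K"
      unfolding eq using u by (simp add: std_normal_exp power_mult_distrib mult_exp_exp)
    then show "(\<integral>\<^sup>+x. ennreal x \<partial>lognormal_law s K u) = ennreal K"
      using nn_integral_eq_integral[OF int] K by (simp add: nn_integral_lognormal_law)
  qed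
  also have "\<dots> = ennreal K" using E.emeasure_space_1 by simp
  finally have nn: "(\<integral>\<^sup>+x. ennreal x \<partial>wealth_law s lam K) = ennreal K" .
  have "prob {0<..} = 1" using wealth_law_positive[OF lam K, of s] by (simp add: emeasure_eq_measure)
  then have "AE x in wealth_law s lam K. x \<in> {0<..}" by (subst AE_in_set_eq_1) simp_all
  then have pos: "AE x in wealth_law s lam K. 0 \<le> x" by eventually_elim simp
  show "integrable (wealth_law s lam K) (\<lambda>x. x)"
    by (rule integrableI_nn_integral_finite[OF _ pos nn]) simp
  show "(\<integral>x. x \<partial>wealth_law s lam K) = K"
    using integral_eq_nn_integral[OF _ pos] nn K by simp
qed

lemma wealth_law_eq_double_pareto:
  assumes "0 < lam" "s \<noteq> 0" "0 < \<alpha>" "0 < \<kappa>" "\<kappa> = \<alpha> - 1" "\<alpha> * \<kappa> = 2 * lam / s\<^sup>2" "0 < K"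
  shows "wealth_law s lam K = density lborel (double_pareto_density K \<alpha> \<kappa>)"
  unfolding wealth_law_def log_wealth_law_eq_laplace[OF assms(1-6)]
  by (rule laplace_exp_eq_double_pareto[OF assms(7)])

section \<open>Stationarity characterises the mixture\<close>

text \<open>The inequality for the complement is the reverse inequality for the set, as both masses
  are 1. An upper bound therefore suffices to identify a stationary law.\<close>

lemma prob_space_eqI_le:
  assumes "prob_space D" "prob_space W" and sets: "sets D = sets W"
    and le: "\<And>A. A \<in> sets W \<Longrightarrow> emeasure D A \<le> emeasure W A"
  shows "D = W"
proof (rule measure_eqI[OF sets])
  interpret D: prob_space D by fact
  interpret W: prob_space W by fact
  fix A assume "A \<in> sets D"
  then have A: "A \<in> sets D" "A \<in> sets W" using sets by auto
  have "D.prob A \<le> W.prob A" "D.prob (space D - A) \<le> W.prob (space W - A)"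
    using le[of A] le[of "space W - A"] A sets_eq_imp_space_eq[OF sets]
    by (auto simp: D.emeasure_eq_measure W.emeasure_eq_measure)
  then show "emeasure D A = emeasure W A"
    using A by (simp add: D.emeasure_eq_measure W.emeasure_eq_measure D.prob_compl W.prob_compl)
qed

text \<open>The reflection exchanges the date of entry with the age at \<open>t\<close>.\<close>

lemma nn_integral_reflect_Icc:
  fixes f :: "real \<Rightarrow> ennreal"
  assumes [measurable]: "f \<in> borel_measurable borel"
  shows "(\<integral>\<^sup>+u\<in>{0..t}. f (t - u) \<partial>lborel) = (\<integral>\<^sup>+u\<in>{0..t}. f u \<partial>lborel)"
  by (subst nn_integral_real_affine[where c = "- 1" and t = t])
    (auto intro!: nn_integral_cong simp: indicator_def)

context brownian_motion
begin

text \<open>The right-hand side of the stationarity condition: survivors of the initial cross-section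
  \<open>D\<close>, and entrants sorted by age instead of date of entry.\<close>

lemma cross_section_eq:
  assumes exit: "exit_time M \<F> lam T" and lam: "0 < lam" and s: "s \<noteq> 0" and K: "0 < K"
    and D: "prob_space D" "sets D = sets borel" "emeasure D {0<..} = 1"
    and X: "\<And>x. 0 < x \<Longrightarrow> sde_solution M \<F> B (\<lambda>k. 0 * k) (\<lambda>k. s * k) x (X x)"
    and t: "0 \<le> t" and A[measurable]: "A \<in> sets borel"
  shows "(\<integral>\<^sup>+x. active_in M T (X x) t A \<partial>D) +
      (\<integral>\<^sup>+u\<in>{0..t}. ennreal lam * active_in M T (X K) (t - u) A \<partial>lborel) =
    ennreal (exp (- lam * t)) * (\<integral>\<^sup>+x. emeasure (lognormal_law s x t) A \<partial>D) +
      (\<integral>\<^sup>+u\<in>{0..t}. ennreal (lam * exp (- lam * u)) * emeasure (lognormal_law s K u) A \<partial>lborel)"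
proof -
  interpret D: prob_space D by fact
  note [measurable] = emeasure_lognormal_law_measurable[OF A]
  note [measurable_cong] = D(2)
  note active = active_in_linear_sde[OF exit lam s _ X A]
  \<comment> \<open>Solutions are available only from positive starting values, which are
    \<open>D\<close>-almost all of them.\<close>
  have "D.prob {0<..} = 1" using D(3) by (simp add: D.emeasure_eq_measure)
  then have "AE x in D. x \<in> {0<..}" by (subst D.AE_in_set_eq_1) (simp_all add: D(2))
  then have "(\<integral>\<^sup>+x. active_in M T (X x) t A \<partial>D) =
      (\<integral>\<^sup>+x. ennreal (exp (- lam * t)) * emeasure (lognormal_law s x t) A \<partial>D)"
    by (rule nn_integral_cong_AE[OF eventually_mono]) (simp add: active[OF t])
  also have "\<dots> = ennreal (exp (- lam * t)) * (\<integral>\<^sup>+x. emeasure (lognormal_law s x t) A \<partial>D)"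
    by (intro nn_integral_cmult) measurable
  moreover have "(\<integral>\<^sup>+u\<in>{0..t}. ennreal lam * active_in M T (X K) (t - u) A \<partial>lborel) =
      (\<integral>\<^sup>+u\<in>{0..t}. ennreal (lam * exp (- lam * (t - u))) * emeasure (lognormal_law s K (t - u)) A \<partial>lborel)"
    using lam by (intro nn_integral_cong)
      (auto simp: active[OF _ K] indicator_def ennreal_mult mult.assoc)
  moreover have "\<dots> = (\<integral>\<^sup>+u\<in>{0..t}. ennreal (lam * exp (- lam * u)) * emeasure (lognormal_law s K u) A \<partial>lborel)"
    by (rule nn_integral_reflect_Icc) measurable
  ultimately show ?thesis by simp
qed

text \<open>Survivors have mass at most \<open>exp (- lam * n)\<close> and entrants are bounded by
  the integral over all ages, which is the mixture; letting \<open>n\<close> grow gives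
  \<open>D \<le> wealth_law s lam K\<close> on every Borel set.\<close>

lemma stationary_eq_wealth_law:
  assumes exit: "exit_time M \<F> lam T" and lam: "0 < lam" and s: "s \<noteq> 0" and K: "0 < K"
    and D: "prob_space D" "sets D = sets borel" "emeasure D {0<..} = 1"
    and X: "\<And>x. 0 < x \<Longrightarrow> sde_solution M \<F> B (\<lambda>k. 0 * k) (\<lambda>k. s * k) x (X x)"
    and stationary: "\<And>t A. 0 \<le> t \<Longrightarrow> A \<in> sets borel \<Longrightarrow> emeasure D A =
      (\<integral>\<^sup>+x. active_in M T (X x) t A \<partial>D) +
      (\<integral>\<^sup>+u\<in>{0..t}. ennreal lam * active_in M T (X K) (t - u) A \<partial>lborel)"
  shows "D = wealth_law s lam K"
proof (rule prob_space_eqI_le[OF D(1) prob_space_wealth_law[OF lam]])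
  interpret D: prob_space D by fact
  fix A assume "A \<in> sets (wealth_law s lam K)"
  then have A: "A \<in> sets borel" by simp
  have "emeasure D A \<le> ennreal (exp (- lam * real n)) + emeasure (wealth_law s lam K) A" for n :: nat
  proof -
    have "(\<integral>\<^sup>+x. emeasure (lognormal_law s x (real n)) A \<partial>D) \<le> (\<integral>\<^sup>+x. 1 \<partial>D)"
      by (intro nn_integral_mono) (rule prob_space.emeasure_le_1[OF prob_space_lognormal_law])
    also have "\<dots> = 1" using D.emeasure_space_1 by simp
    finally have "ennreal (exp (- lam * real n)) * (\<integral>\<^sup>+x. emeasure (lognormal_law s x (real n)) A \<partial>D) \<le>
        ennreal (exp (- lam * real n)) * 1"
      by (rule mult_left_mono) simp
    moreover have "(\<integral>\<^sup>+u\<in>{0..real n}. ennreal (lam * exp (- lam * u)) * emeasure (lognormal_law s K u) A \<partial>lborel)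
        \<le> emeasure (wealth_law s lam K) A"
      unfolding emeasure_wealth_law[OF lam A]
      by (intro nn_integral_mono mult_left_mono) (auto simp: indicator_def)
    ultimately show ?thesis
      using stationary[OF _ A, of "real n"] cross_section_eq[OF exit lam s K D X _ A, of "real n"]
      by (simp add: add_mono)
  qed
  moreover have "(\<lambda>n. ennreal (exp (- lam * real n)) + emeasure (wealth_law s lam K) A)
      \<longlonglongrightarrow> ennreal 0 + emeasure (wealth_law s lam K) A"
  proof (intro tendsto_add tendsto_ennrealI tendsto_const)
    have "(\<lambda>n. exp (- lam) ^ n) \<longlonglongrightarrow> 0"
      using lam by (intro LIMSEQ_power_zero) simp
    then show "(\<lambda>n. exp (- lam * real n)) \<longlonglongrightarrow> 0"
      by (simp add: exp_of_nat_mult[symmetric] mult.commute)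
  qed
  ultimately show "emeasure D A \<le> emeasure (wealth_law s lam K) A"
    using LIMSEQ_le_const by fastforce
qed (simp add: D)

text \<open>The integral over ages is cut at \<open>t\<close>. Ages below \<open>t\<close> are the
  entrants; ages above \<open>t\<close>, shifted by \<open>t\<close>, are the survivors, because the
  semigroup property ages the initial mixture and \<open>exp (- lam * t)\<close> supplies the
  missing weight.\<close>

lemma wealth_law_stationary:
  assumes exit: "exit_time M \<F> lam T" and lam: "0 < lam" and s: "s \<noteq> 0" and K: "0 < K"
    and X: "\<And>x. 0 < x \<Longrightarrow> sde_solution M \<F> B (\<lambda>k. 0 * k) (\<lambda>k. s * k) x (X x)"
    and t: "0 \<le> t" and A[measurable]: "A \<in> sets borel"
  shows "emeasure (wealth_law s lam K) A =
    (\<integral>\<^sup>+x. active_in M T (X x) t A \<partial>wealth_law s lam K) +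
    (\<integral>\<^sup>+u\<in>{0..t}. ennreal lam * active_in M T (X K) (t - u) A \<partial>lborel)"
proof -
  note [measurable] = emeasure_lognormal_law_measurable[OF A]
  define G where "G u = emeasure (lognormal_law s K u) A" for u
  have [measurable]: "G \<in> borel_measurable borel" unfolding G_def by measurable
  have "ennreal (exp (- lam * t)) * (\<integral>\<^sup>+x. emeasure (lognormal_law s x t) A \<partial>wealth_law s lam K) =
      ennreal (exp (- lam * t)) * (\<integral>\<^sup>+u\<in>{0..}. ennreal (lam * exp (- lam * u)) * G (u + t) \<partial>lborel)"
    using lognormal_law_semigroup[OF _ t A, of _ s K]
    by (simp add: nn_integral_wealth_law nn_integral_exponential_law[OF lam] G_def)
      (rule arg_cong2[where f = "(*)", OF refl], rule nn_integral_cong, simp add: indicator_def)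
  \<comment> \<open>The form \<open>t + 1 * u\<close> presents the integrand as an affine
    substitution with slope 1.\<close>
  also have "\<dots> = (\<integral>\<^sup>+u. ennreal (lam * exp (- lam * (t + 1 * u))) * G (t + 1 * u) * indicator {t..} (t + 1 * u) \<partial>lborel)"
  proof (subst nn_integral_cmult[symmetric], measurable, rule nn_integral_cong)
    fix u
    have "ennreal (exp (- lam * t)) * ennreal (lam * exp (- lam * u)) = ennreal (lam * exp (- lam * (t + u)))"
      using lam by (simp add: ennreal_mult[symmetric] exp_add[symmetric] distrib_left)
    then show "ennreal (exp (- lam * t)) * (ennreal (lam * exp (- lam * u)) * G (u + t) * indicator {0..} u) =
      ennreal (lam * exp (- lam * (t + 1 * u))) * G (t + 1 * u) * indicator {t..} (t + 1 * u)"
      by (simp only: mult.assoc[symmetric] mult_1 add.commute[of u t]) (simp add: indicator_def)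
  qed
  also have "\<dots> = (\<integral>\<^sup>+u\<in>{t..}. ennreal (lam * exp (- lam * u)) * G u \<partial>lborel)"
    by (subst nn_integral_real_affine[where c = 1 and t = t]) auto
  finally have survivors: "ennreal (exp (- lam * t)) * (\<integral>\<^sup>+x. emeasure (lognormal_law s x t) A \<partial>wealth_law s lam K) =
      (\<integral>\<^sup>+u\<in>{t..}. ennreal (lam * exp (- lam * u)) * G u \<partial>lborel)" .
  have "emeasure (wealth_law s lam K) A = (\<integral>\<^sup>+u\<in>{0..}. ennreal (lam * exp (- lam * u)) * G u \<partial>lborel)"
    by (simp only: emeasure_wealth_law[OF lam A] G_def)
  \<comment> \<open>The two age ranges overlap only at the point \<open>t\<close>, a null
    set.\<close>
  also have "\<dots> = (\<integral>\<^sup>+u. ennreal (lam * exp (- lam * u)) * G u * indicator {t..} u +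
      ennreal (lam * exp (- lam * u)) * G u * indicator {0..t} u \<partial>lborel)"
    using t by (intro nn_integral_cong_AE[OF eventually_mono[OF AE_lborel_singleton[of t]]])
      (auto simp: indicator_def)
  also have "\<dots> = (\<integral>\<^sup>+u\<in>{t..}. ennreal (lam * exp (- lam * u)) * G u \<partial>lborel) +
      (\<integral>\<^sup>+u\<in>{0..t}. ennreal (lam * exp (- lam * u)) * G u \<partial>lborel)"
    by (rule nn_integral_add) measurable
  finally have W: "emeasure (wealth_law s lam K) A =
      (\<integral>\<^sup>+u\<in>{t..}. ennreal (lam * exp (- lam * u)) * G u \<partial>lborel) +
      (\<integral>\<^sup>+u\<in>{0..t}. ennreal (lam * exp (- lam * u)) * G u \<partial>lborel)" .
  show ?thesis
    unfolding W survivors[symmetric] unfolding G_def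
    by (rule cross_section_eq[symmetric, OF exit lam s K prob_space_wealth_law[OF lam] sets_wealth_law
        wealth_law_positive[OF lam K] X t A])
qed

end

section \<open>The steady state\<close>

lemma steady_state_iff:
  "steady_state F L \<beta> \<tau> K \<longleftrightarrow> 0 < K \<and> growth_rate F L \<beta> \<tau> K = 0"
proof
  assume "steady_state F L \<beta> \<tau> K"
  \<comment> \<open>Time 1 is interior to \<open>{0..}\<close>, so the derivative there is two-sided
    and unique.\<close>
  then have K: "0 < K"
    and "((\<lambda>_. K) has_real_derivative growth_rate F L \<beta> \<tau> K * K) (at 1 within {0..})"
    by (auto simp: steady_state_def aggregate_dynamics_def dest: spec[of _ 1])
  moreover have "at (1 :: real) within {0..} = at 1"
    by (rule at_within_interior) (simp add: interior_real_atLeast)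
  ultimately have "((\<lambda>_. K) has_real_derivative growth_rate F L \<beta> \<tau> K * K) (at 1)" by simp
  then have "growth_rate F L \<beta> \<tau> K * K = 0" by (rule DERIV_unique) (rule DERIV_const)
  then show "0 < K \<and> growth_rate F L \<beta> \<tau> K = 0" using K by simp
next
  assume "0 < K \<and> growth_rate F L \<beta> \<tau> K = 0"
  then show "steady_state F L \<beta> \<tau> K"
    by (simp add: steady_state_def aggregate_dynamics_def)
qed

text \<open>The condition is \<open>f' (K / L) = \<beta> / (1 - \<tau>)\<close>, a positive level.
  The infinite limit of \<open>f'\<close> at 0 and its nonpositive limit at infinity bracket it for
  the intermediate value theorem, and \<open>f'' < 0\<close> makes the solution unique.\<close>

lemma steady_state_ex1:
  assumes F: "production_function F" and "0 < L" "0 < \<beta>" "\<tau> < 1"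
  shows "\<exists>!K. steady_state F L \<beta> \<tau> K"
proof -
  define f' where "f' = deriv (intensive F)"
  define c where "c = \<beta> / (1 - \<tau>)"
  have c: "0 < c" using assms by (simp add: c_def)
  have iff: "steady_state F L \<beta> \<tau> K \<longleftrightarrow> 0 < K \<and> f' (K / L) = c" for K
    using assms by (auto simp: steady_state_iff growth_rate_def f'_def c_def field_simps)
  have DERIV: "(f' has_real_derivative deriv f' k) (at k)" "deriv f' k < 0" if "0 < k" for k
    using F that by (auto simp: production_function_def f'_def DERIV_deriv_iff_real_differentiable)
  have decreasing: "f' b < f' a" if "0 < a" "a < b" for a b
    by (rule DERIV_neg_imp_decreasing[OF that(2)]) (meson DERIV that(1) order_less_le_trans)
  have "filterlim f' at_top (at_right 0)" using F by (simp add: production_function_def f'_def)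
  then have "eventually (\<lambda>k. c < f' k) (at_right 0)" by (simp add: filterlim_at_top_dense)
  then obtain b where "0 < b" "\<And>k. 0 < k \<Longrightarrow> k < b \<Longrightarrow> c < f' k"
    by (auto simp: eventually_at_right_field)
  then have k1: "0 < b / 2" "c < f' (b / 2)" by simp_all
  obtain l :: ereal where l: "l \<le> 0" "((\<lambda>k. ereal (f' k)) \<longlongrightarrow> l) at_top"
    using F by (auto simp: production_function_def f'_def)
  have "l < ereal c" using l(1) c by (metis ereal_less(2) order_le_less_trans)
  with l(2) have "eventually (\<lambda>k. ereal (f' k) < ereal c) at_top" by (rule order_tendstoD)
  then have "eventually (\<lambda>k. f' k < c \<and> b / 2 \<le> k) at_top"
    using eventually_ge_at_top[of "b / 2"] by eventually_elim simp
  then obtain k2 where k2: "f' k2 < c" "b / 2 \<le> k2" by (auto simp: eventually_at_top_linorder)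
  have "\<exists>k\<ge>b / 2. k \<le> k2 \<and> f' k = c"
    using k1 k2
    by (intro IVT2) (auto intro!: DERIV_isCont[OF DERIV(1)])
  then obtain k where k: "0 < k" "f' k = c" using k1(1) by (metis order_less_le_trans)
  show ?thesis
  proof (rule ex1I[of _ "k * L"])
    show "steady_state F L \<beta> \<tau> (k * L)" using k assms by (simp add: iff)
    fix K assume "steady_state F L \<beta> \<tau> K"
    then have K: "0 < K / L" "f' (K / L) = c" using assms by (simp_all add: iff)
    have "K / L = k"
      using decreasing[of "K / L" k] decreasing[of k "K / L"] K k by (cases "K / L" k rule: linorder_cases) auto
    then show "K = k * L" using assms by auto
  qed
qed

section \<open>The quadratic equation for the Pareto exponent\<close>

text \<open>Here \<open>v\<close> stands for \<open>s\<^sup>2\<close> and \<open>r\<close> for the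
  root of the discriminant, so that \<open>\<alpha> * (\<alpha> - 1) = (r\<^sup>2 - 1) / 4\<close>.
  The bound \<open>1 < \<alpha>\<close> makes \<open>\<kappa> = \<alpha> - 1\<close>
  admissible.\<close>

lemma pareto_exponent_roots:
  fixes lam v :: real
  assumes "0 < lam" "0 < v"
  defines "\<alpha> \<equiv> 1/2 * (1 + sqrt (1 + 8 * lam / v))"
  shows "1 < \<alpha>" "\<alpha> * (\<alpha> - 1) = 2 * lam / v"
proof -
  define r where "r = sqrt (1 + 8 * lam / v)"
  have q: "0 < 8 * lam / v" using assms by simp
  have "1 < r" unfolding r_def using q by simp
  then show "1 < \<alpha>" by (simp add: \<alpha>_def r_def[symmetric])
  have "r\<^sup>2 = 1 + 8 * lam / v" unfolding r_def using q by simp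
  moreover have "\<alpha> = 1/2 * (1 + r)" by (simp add: \<alpha>_def r_def)
  then have "\<alpha> * (\<alpha> - 1) = 1/2 * (1 + r) * (1/2 * (1 + r) - 1)" by (simp only:)
  then have "\<alpha> * (\<alpha> - 1) = (r\<^sup>2 - 1) / 4" by (simp add: algebra_simps power2_eq_square)
  ultimately show "\<alpha> * (\<alpha> - 1) = 2 * lam / v" by simp
qed

text \<open>A higher tax rate lowers after-tax volatility, so exit occurs before wealth has spread
  as far, and the tail is thinner.\<close>

lemma pareto_exponent_strict_mono:
  fixes lam \<sigma> :: real
  assumes "0 < lam" "0 < \<sigma>"
  shows "strict_mono_on {0..<1} (\<lambda>\<theta>::real. 1/2 * (1 + sqrt (1 + 8 * lam / ((1 - \<theta>)\<^sup>2 * \<sigma>\<^sup>2))))"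
proof (rule strict_mono_onI)
  fix a b :: real assume ab: "a \<in> {0..<1}" "b \<in> {0..<1}" "a < b"
  have "(1 - b)\<^sup>2 < (1 - a)\<^sup>2" using ab by (intro power_strict_mono) auto
  then have "8 * lam / ((1 - a)\<^sup>2 * \<sigma>\<^sup>2) < 8 * lam / ((1 - b)\<^sup>2 * \<sigma>\<^sup>2)"
    using ab assms by (intro divide_strict_left_mono mult_strict_right_mono) auto
  then show "1/2 * (1 + sqrt (1 + 8 * lam / ((1 - a)\<^sup>2 * \<sigma>\<^sup>2))) < 1/2 * (1 + sqrt (1 + 8 * lam / ((1 - b)\<^sup>2 * \<sigma>\<^sup>2)))"
    by simp
qed

theorem proposition2:
  fixes M :: "'a measure" and \<F> :: "real \<Rightarrow> 'a measure"
    and B :: "real \<Rightarrow> 'a \<Rightarrow> real" and T :: "'a \<Rightarrow> real"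
    and F :: "real \<Rightarrow> real \<Rightarrow> real"
    and L \<beta> \<gamma> \<sigma> lam \<tau> :: real
  assumes "standard_brownian_motion M \<F> B"
    and "exit_time M \<F> lam T"
    and "production_function F"
    and "L > 0" and "\<beta> > 0" and "\<gamma> > 0" and "\<gamma> \<noteq> 1"
    and "\<sigma> > 0" and "lam > 0" and "0 \<le> \<tau>" and "\<tau> < 1"
  shows "(\<exists>!D. stationary_wealth_distribution M \<F> B T F L \<beta> \<sigma> lam \<tau> D) \<and>
    (\<forall>D. stationary_wealth_distribution M \<F> B T F L \<beta> \<sigma> lam \<tau> D \<longrightarrow>
       double_pareto D (1/2 * (1 + sqrt (1 + 8 * lam / ((1 - \<tau>)\<^sup>2 * \<sigma>\<^sup>2))))) \<and>
    strict_mono_on {0..<1}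
      (\<lambda>\<theta>::real. 1/2 * (1 + sqrt (1 + 8 * lam / ((1 - \<theta>)\<^sup>2 * \<sigma>\<^sup>2))))"
proof -
  interpret brownian_motion M \<F> B by (rule brownian_motion.intro) fact
  note exit = \<open>exit_time M \<F> lam T\<close> and lam = \<open>lam > 0\<close>
  define s where "s = (1 - \<tau>) * \<sigma>"
  have s: "s \<noteq> 0" "s\<^sup>2 = (1 - \<tau>)\<^sup>2 * \<sigma>\<^sup>2" "0 < (1 - \<tau>)\<^sup>2 * \<sigma>\<^sup>2"
    using assms by (auto simp: s_def power_mult_distrib)
  obtain K where steady: "steady_state F L \<beta> \<tau> K"
    and K_unique: "\<And>K'. steady_state F L \<beta> \<tau> K' \<Longrightarrow> K' = K"
    using steady_state_ex1[of F L \<beta> \<tau>] assms by blast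
  have K: "0 < K" "growth_rate F L \<beta> \<tau> K = 0" using steady by (simp_all add: steady_state_iff)
  have process: "capital_process M \<F> B F L \<beta> \<sigma> \<tau> K x Y \<longleftrightarrow>
      sde_solution M \<F> B (\<lambda>k. 0 * k) (\<lambda>k. s * k) x Y" for x Y
    by (simp only: capital_process_def K(2) s_def)
  let ?W = "wealth_law s lam K"
  have unique: "D = ?W" if "stationary_wealth_distribution M \<F> B T F L \<beta> \<sigma> lam \<tau> D" for D
  proof -
    from that obtain K' X where D: "prob_space D" "sets D = sets borel" "emeasure D {0<..} = 1"
      and K': "steady_state F L \<beta> \<tau> K'"
      and X: "\<forall>x>0. capital_process M \<F> B F L \<beta> \<sigma> \<tau> K' x (X x)"
      and eq: "\<forall>t\<ge>0. \<forall>A\<in>sets borel. emeasure D A =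
             (\<integral>\<^sup>+x. active_in M T (X x) t A \<partial>D) +
             (\<integral>\<^sup>+u\<in>{0..t}. ennreal lam * active_in M T (X K') (t - u) A \<partial>lborel)"
      unfolding stationary_wealth_distribution_def by blast
    \<comment> \<open>The aggregate level is only asserted to exist in the definition; uniqueness of
      the steady state identifies it, and with it the entry point.\<close>
    note K'_eq = K_unique[OF K']
    show ?thesis
      using X eq unfolding K'_eq process
      by (intro stationary_eq_wealth_law[OF exit lam s(1) K(1) D, of X]) blast+
  qed
  have stationary: "stationary_wealth_distribution M \<F> B T F L \<beta> \<sigma> lam \<tau> ?W"
    unfolding stationary_wealth_distribution_def
  \<comment> \<open>The exponentials driven by the given \<open>B\<close> provide the required
    family of solutions.\<close>
  proof (intro conjI exI[of _ K] exI[of _ "geometric s"] allI impI ballI)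
    show "capital_process M \<F> B F L \<beta> \<sigma> \<tau> K x (geometric s x)" for x
      unfolding process by (rule geometric_sde_solution)
    show "emeasure ?W A = (\<integral>\<^sup>+x. active_in M T (geometric s x) t A \<partial>?W) +
        (\<integral>\<^sup>+u\<in>{0..t}. ennreal lam * active_in M T (geometric s K) (t - u) A \<partial>lborel)"
      if "0 \<le> t" "A \<in> sets borel" for t A
      using that by (intro wealth_law_stationary[OF exit lam s(1) K(1)] geometric_sde_solution)
  qed (use prob_space_wealth_law[OF lam] wealth_law_positive[OF lam K(1)] wealth_law_mean[OF lam K(1)]
      steady in simp_all)
  let ?\<alpha> = "1/2 * (1 + sqrt (1 + 8 * lam / ((1 - \<tau>)\<^sup>2 * \<sigma>\<^sup>2)))"
  note \<alpha> = pareto_exponent_roots[OF lam s(3)]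
  have pos: "0 < ?\<alpha>" "0 < ?\<alpha> - 1" using \<alpha>(1) by linarith+
  \<comment> \<open>Choosing \<open>\<kappa> = \<alpha> - 1\<close> satisfies both conditions of the
    Laplace factorisation, and the break point is \<open>K\<close>.\<close>
  have "?W = density lborel (double_pareto_density K ?\<alpha> (?\<alpha> - 1))"
    by (rule wealth_law_eq_double_pareto[OF lam s(1) pos refl _ K(1)]) (simp only: \<alpha>(2) s(2))
  then have "double_pareto ?W ?\<alpha>"
    unfolding double_pareto_def using pos K(1) by blast
  then show ?thesis
    using unique stationary pareto_exponent_strict_mono[OF lam \<open>\<sigma> > 0\<close>] by blast
qed

end
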